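(* Let $A$ be an infinite finitely generated abelian group. Then $A$ admits an inverse ambiguous automorphism if and only if \[ A\cong\mathbb{Z}^{2m}\oplus T \] for some integer $m\geq 1$ and some finite abelian group $T$ whose primary components $T_p$ ($p$ prime) satisfy the following conditions. (i) If $p\equiv 1\pmod 4$, then $T_p$ is arbitrary. (ii) If $p\equiv 3\pmod 4$, then \[ T_p\cong\bigoplus_{k\geq 1}C_{p^k}^{\,2m_{p,k}} \] for non-negative integers $m_{p,k}$, all but finitely many of which are zero. (iii) The $2$-primary component has the form \[ T_2\cong E\oplus\bigoplus_{j=1}^{s}\left(C_{2^{a_j}}\oplus C_{2^{b_j}}\right), \] where $s$ is a non-negative integer, $E$ is an elementary abelian $2$-group, the integers $a_j,b_j$ are positive, and $|a_j-b_j|\leq 1$ for every $j$.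
   Context: A bijection $f$ of a group $G$ onto itself is called inverse ambiguous if $f^{-1}(x)=f(x)^{-1}$ for every $x\in G$, where $f^{-1}(x)$ is the preimage of $x$ under $f$ and $f(x)^{-1}$ is the group inverse of $f(x)$. An inverse ambiguous automorphism is a group automorphism that is inverse ambiguous; for an abelian group written additively, this means an automorphism $J$ with $J^{-1}(x)=-J(x)$ for all $x$. $C_n$ denotes the cyclic group of order $n$, and $T_p$ denotes the $p$-primary component of $T$. An elementary abelian $2$-group is an abelian group in which every element $x$ satisfies $2x=0$ (the trivial group is allowed). *)

theory Defs
  imports
    "HOL-Algebra.Generated_Groups"
    "HOL-Algebra.Product_Groups"
    "HOL-Number_Theory.Cong"
    "HOL-Computational_Algebra.Primes"
begin

(* Only the values of f on carrier G matter; inv_into gives the preimage under f. *)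
definition inverse_ambiguous :: "('a, 'b) monoid_scheme \<Rightarrow> ('a \<Rightarrow> 'a) \<Rightarrow> bool"
  where "inverse_ambiguous G f \<longleftrightarrow>
    bij_betw f (carrier G) (carrier G) \<and>
    (\<forall>x\<in>carrier G. inv_into (carrier G) f x = inv\<^bsub>G\<^esub> (f x))"

definition inverse_ambiguous_automorphism :: "('a, 'b) monoid_scheme \<Rightarrow> ('a \<Rightarrow> 'a) \<Rightarrow> bool"
  where "inverse_ambiguous_automorphism G f \<longleftrightarrow> f \<in> iso G G \<and> inverse_ambiguous G f"

definition finitely_generated_group :: "('a, 'b) monoid_scheme \<Rightarrow> bool"
  where "finitely_generated_group G \<longleftrightarrow>
    group G \<and> (\<exists>S. finite S \<and> S \<subseteq> carrier G \<and> generate G S = carrier G)"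

definition direct_power :: "('a, 'b) monoid_scheme \<Rightarrow> nat \<Rightarrow> (nat \<Rightarrow> 'a) monoid"
  where "direct_power G n = product_group {..<n} (\<lambda>_. G)"

definition primary_component :: "nat \<Rightarrow> ('a, 'b) monoid_scheme \<Rightarrow> ('a, 'b) monoid_scheme"
  where "primary_component p G =
    G\<lparr>carrier := {x \<in> carrier G. \<exists>k::nat. x [^]\<^bsub>G\<^esub> (p ^ k) = \<one>\<^bsub>G\<^esub>}\<rparr>"

definition elementary_abelian_2_group :: "('a, 'b) monoid_scheme \<Rightarrow> bool"
  where "elementary_abelian_2_group G \<longleftrightarrow>
    comm_group G \<and> (\<forall>x\<in>carrier G. x \<otimes>\<^bsub>G\<^esub> x = \<one>\<^bsub>G\<^esub>)"

end

theory Submission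
  imports Defs "HOL-Algebra.Weak_Morphisms" "HOL-Number_Theory.Euler_Criterion"
begin

text \<open>An automorphism is inverse ambiguous iff its square is inversion, so it makes the group a module
  over \<open>\<int>[i]\<close>. As \<open>\<int>[i]\<close> is Euclidean, a finitely generated module is a direct sum of cyclic
  modules \<open>\<int>[i]/(c)\<close>: those with \<open>c = 0\<close> contribute \<open>\<int>\<^sup>2\<close> each, the others are finite. A primary
  component of the finite part is again such a module. If \<open>p \<equiv> 3\<close> mod 4, then \<open>p\<close> is prime in \<open>\<int>[i]\<close>
  and the cyclic summands are \<open>\<int>[i]/(p\<^sup>k)\<close>, i.e. sums of two cyclic groups of order \<open>p\<^sup>k\<close>; for \<open>p = 2\<close> they are
  \<open>\<int>[i]/((1 + i)\<^sup>n)\<close>, which is a sum of cyclic groups of orders \<open>2\<close> to the powers \<open>\<lceil>n/2\<rceil>\<close> and \<open>\<lfloor>n/2\<rfloor>\<close>;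
  the summands with \<open>n = 1\<close> make up \<open>E\<close>. Conversely, each of these groups carries multiplication by \<open>i\<close>,
  and for \<open>p \<equiv> 1\<close> mod 4 a square root of \<open>-1\<close> modulo \<open>p\<^sup>k\<close> acts on an arbitrary \<open>p\<close>-primary group.\<close>

subsection \<open>Finitely generated modules over Euclidean domains\<close>

text \<open>The theorem speaks of additive shapes, while module theory yields quotients Z[i]/(c).
  The bridge is a Z-basis of Z[i] in which the ideal is diagonal: 1 and i when c is an integer, 1
  and 1 + i when c is a power of 1 + i. Shapes are then compared as multisets of cyclic orders,
  where order 0 stands for Z; factors of order 1 have to be discarded, because the required forms
  admit positive exponents only. Since 2 is a unit times the square of 1 + i, even powers of 1 + i
  give two equal 2-power orders, and odd ones give two orders with exponents differing by 1. A prime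
  congruent to 1 mod 4 splits into two conjugate primes of Z[i], and modulo a power of either one
  Z[i] is additively cyclic of p-power order; this is why such components are unrestricted. In the
  converse each primary component is known only up to isomorphism. It receives a multiplication by i
  of its own, and these are glued by splitting the finite group into its torsion for coprime numbers
  with Bezout coefficients.\<close>

locale euclidean_action = comm_group G for G (structure) +
  fixes smult :: "'r::idom \<Rightarrow> 'a \<Rightarrow> 'a" (infixr "\<cdot>" 75) and size :: "'r \<Rightarrow> nat"
  assumes smult_closed [simp, intro]: "x \<in> carrier G \<Longrightarrow> r \<cdot> x \<in> carrier G"
    and smult_add: "x \<in> carrier G \<Longrightarrow> (r + s) \<cdot> x = r \<cdot> x \<otimes> s \<cdot> x"
    and smult_mult: "x \<in> carrier G \<Longrightarrow> (r * s) \<cdot> x = r \<cdot> s \<cdot> x"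
    and smult_one [simp]: "x \<in> carrier G \<Longrightarrow> 1 \<cdot> x = x"
    and smult_distrib: "\<lbrakk>x \<in> carrier G; y \<in> carrier G\<rbrakk> \<Longrightarrow> r \<cdot> (x \<otimes> y) = r \<cdot> x \<otimes> r \<cdot> y"
    and euclid: "s \<noteq> 0 \<Longrightarrow> \<exists>q. size (r - s * q) < size s"
begin

lemma smult_zero [simp]: "x \<in> carrier G \<Longrightarrow> 0 \<cdot> x = \<one>"
  using smult_add[of x 0 0] smult_closed[of x 0] by (metis add_0 l_cancel_one)

lemma smult_id [simp]: "r \<cdot> \<one> = \<one>"
  using smult_distrib[of "\<one>" "\<one>" r] smult_closed[of "\<one>" r] by (metis l_cancel_one one_closed l_one)

text \<open>Generators form an indexed family instead of a set of elements, since a change of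
  generators may make members coincide or become trivial while each index must keep its own
  coefficient.\<close>

definition lin :: "'i set \<Rightarrow> ('i \<Rightarrow> 'r) \<Rightarrow> ('i \<Rightarrow> 'a) \<Rightarrow> 'a"
  where "lin I r y = finprod G (\<lambda>j. r j \<cdot> y j) I"

definition span :: "'i set \<Rightarrow> ('i \<Rightarrow> 'a) \<Rightarrow> 'a set"
  where "span I y = range (\<lambda>r. lin I r y)"

lemma lin_closed [simp, intro]: "y \<in> I \<rightarrow> carrier G \<Longrightarrow> lin I r y \<in> carrier G"
  unfolding lin_def by (intro finprod_closed) auto

lemma lin_cong:
  "\<lbrakk>y \<in> I \<rightarrow> carrier G; \<And>j. j \<in> I \<Longrightarrow> r j = r' j; \<And>j. j \<in> I \<Longrightarrow> y j = y' j\<rbrakk> \<Longrightarrow> lin I r y = lin I r' y'"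
  unfolding lin_def by (rule finprod_cong') (auto simp: Pi_iff)

lemma lin_empty [simp]: "lin {} r y = \<one>"
  by (simp add: lin_def)

lemma lin_insert:
  "\<lbrakk>finite I; i \<notin> I; y \<in> insert i I \<rightarrow> carrier G\<rbrakk> \<Longrightarrow> lin (insert i I) r y = r i \<cdot> y i \<otimes> lin I r y"
  unfolding lin_def by (rule finprod_insert) auto

lemma lin_remove:
  "\<lbrakk>finite I; i \<in> I; y \<in> I \<rightarrow> carrier G\<rbrakk> \<Longrightarrow> lin I r y = r i \<cdot> y i \<otimes> lin (I - {i}) r y"
  using lin_insert[of "I - {i}" i y r] by (simp add: insert_absorb)

lemma lin_add:
  "y \<in> I \<rightarrow> carrier G \<Longrightarrow> lin I (\<lambda>j. r j + s j) y = lin I r y \<otimes> lin I s y"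
  unfolding lin_def by (subst finprod_multf [symmetric]) (auto intro!: finprod_cong' simp: smult_add Pi_iff simp del: finprod_multf)

lemma lin_zero: "y \<in> I \<rightarrow> carrier G \<Longrightarrow> (\<And>j. j \<in> I \<Longrightarrow> r j \<cdot> y j = \<one>) \<Longrightarrow> lin I r y = \<one>"
  unfolding lin_def by (intro finprod_one_eqI) auto

lemma lin_smult:
  assumes "finite I" "y \<in> I \<rightarrow> carrier G"
  shows "s \<cdot> lin I r y = lin I (\<lambda>j. s * r j) y"
  using assms
proof (induction I)
  case (insert i I)
  then have "y \<in> I \<rightarrow> carrier G" "y i \<in> carrier G" by auto
  with insert show ?case
    by (simp add: lin_insert smult_distrib smult_mult)
qed simp

text \<open>An elementary change of generators acts on coefficient vectors by the transposed matrix.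
  Both the division step and the elimination step of \<open>exists_basis\<close> are
  instances.\<close>

lemma lin_shear:
  assumes "finite I" "i \<in> I" "y \<in> I \<rightarrow> carrier G"
  shows "lin I r (y(i := y i \<otimes> lin (I - {i}) q y)) =
         lin I (\<lambda>j. if j = i then r i else r j + r i * q j) y"
proof -
  have y: "y \<in> I - {i} \<rightarrow> carrier G" "y i \<in> carrier G"
    using assms by auto
  have "lin I r (y(i := y i \<otimes> lin (I - {i}) q y))
      = r i \<cdot> (y i \<otimes> lin (I - {i}) q y) \<otimes> lin (I - {i}) r (y(i := y i \<otimes> lin (I - {i}) q y))"
    using assms y by (subst lin_remove[of I i]) (auto simp: Pi_iff)
  also have "lin (I - {i}) r (y(i := y i \<otimes> lin (I - {i}) q y)) = lin (I - {i}) r y"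
    using y by (intro lin_cong) (auto simp: Pi_iff)
  also have "r i \<cdot> (y i \<otimes> lin (I - {i}) q y) \<otimes> lin (I - {i}) r y =
      r i \<cdot> y i \<otimes> lin (I - {i}) (\<lambda>j. r j + r i * q j) y"
    using assms y by (simp add: smult_distrib lin_smult lin_add m_ac)
  also have "lin (I - {i}) (\<lambda>j. r j + r i * q j) y =
      lin (I - {i}) (\<lambda>j. if j = i then r i else r j + r i * q j) y"
    using y by (intro lin_cong) auto
  finally show ?thesis
    using lin_remove[OF assms, of "\<lambda>j. if j = i then r i else r j + r i * q j"] by (simp only: if_True refl)
qed

lemma span_shear:
  assumes "finite I" "i \<in> I" "y \<in> I \<rightarrow> carrier G"
  shows "span I (y(i := y i \<otimes> lin (I - {i}) q y)) = span I y"
proof -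
  \<comment> \<open>Subtracting \<open>r i * q j\<close> is the inverse change of coefficients; it
    is available because the shear leaves \<open>r i\<close> itself fixed.\<close>
  have "lin I r y = lin I (\<lambda>j. if j = i then r i else r j - r i * q j) (y(i := y i \<otimes> lin (I - {i}) q y))" for r
    unfolding lin_shear[OF assms] using assms(3) by (intro lin_cong) auto
  then have "span I y \<subseteq> span I (y(i := y i \<otimes> lin (I - {i}) q y))"
    unfolding span_def by blast
  moreover have "span I (y(i := y i \<otimes> lin (I - {i}) q y)) \<subseteq> span I y"
    unfolding span_def using lin_shear[OF assms] by blast
  ultimately show ?thesis by blast
qed

lemma span_remove:
  assumes "finite I" "i \<in> I" "y \<in> I \<rightarrow> carrier G"
  shows "span I y = {a \<cdot> y i \<otimes> z |a z. z \<in> span (I - {i}) y}"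
proof -
  have "a \<cdot> y i \<otimes> lin (I - {i}) r y = lin I (r(i := a)) y" for a r
  proof -
    have "lin (I - {i}) (r(i := a)) y = lin (I - {i}) r y"
      using assms by (intro lin_cong) auto
    then show ?thesis using lin_remove[OF assms, of "r(i := a)"] by simp
  qed
  moreover have "lin I r y \<in> {a \<cdot> y i \<otimes> z |a z. z \<in> span (I - {i}) y}" for r
    unfolding span_def using lin_remove[OF assms] by blast
  ultimately show ?thesis
    unfolding span_def by fastforce
qed

text \<open>Among all relations between all families with the given span, one takes a relation with a
  nonzero coefficient \<open>c\<close> of minimal size. By division with remainder \<open>c\<close> divides the other
  coefficients, so a shear of the family turns the relation into \<open>c \<cdot> y = \<one>\<close>; minimality then shows
  that \<open>c\<close> divides the coefficient of \<open>y\<close> in every relation, which splits \<open>y\<close> off.\<close>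

theorem exists_basis:
  assumes "finite I" "y \<in> I \<rightarrow> carrier G"
  shows "\<exists>y' c. y' \<in> I \<rightarrow> carrier G \<and> span I y' = span I y \<and> (\<forall>j\<in>I. c j \<cdot> y' j = \<one>) \<and>
    (\<forall>r. lin I r y' = \<one> \<longrightarrow> (\<forall>j\<in>I. c j dvd r j))"
  using assms
proof (induction "card I" arbitrary: I y)
  case 0
  then show ?case by auto
next
  case (Suc n)
  \<comment> \<open>The family varies along with the relation and the index: minimality is invoked
    below for a sheared family and for one assembled from the induction hypothesis.\<close>
  define P where "P = (\<lambda>(z, r, i). z \<in> I \<rightarrow> carrier G \<and> span I z = span I y \<and>
     lin I r z = \<one> \<and> i \<in> I \<and> r i \<noteq> (0::'r))"
  show ?case
  proof (cases "\<exists>t. P t")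
    case False
    \<comment> \<open>Without a nonzero relation the generators are free. The choice
      \<open>c = 0\<close> expresses this, as \<open>0 dvd r j\<close> means
      \<open>r j = 0\<close>.\<close>
    then have "\<forall>r. lin I r y = \<one> \<longrightarrow> (\<forall>j\<in>I. 0 dvd r j)"
      unfolding P_def using Suc.prems by auto
    then show ?thesis
      using Suc.prems by (intro exI[of _ y] exI[of _ "\<lambda>_. 0"]) (simp add: Pi_iff)
  next
    case True
    define t where "t = arg_min (\<lambda>(z, r, i). size (r i)) P"
    obtain z r i where zri: "t = (z, r, i)" by (cases t)
    have t: "P t" unfolding t_def using True by (metis arg_min_natI)
    have min: "P (z', r', i') \<Longrightarrow> size (r i) \<le> size (r' i')" for z' r' i'
      using arg_min_nat_le[of P "(z', r', i')" "\<lambda>(z, r, i). size (r i)"]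
      unfolding t_def[symmetric] zri by simp
    have z: "z \<in> I \<rightarrow> carrier G" "span I z = span I y" "lin I r z = \<one>" and i: "i \<in> I" "r i \<noteq> 0"
      using t zri P_def by auto
    have dvd: "r i dvd r j" if "j \<in> I" for j
    proof (cases "j = i")
      case False
      obtain q where q: "size (r j - r i * q) < size (r i)"
        using euclid i(2) by blast
      \<comment> \<open>Adding \<open>q\<close> times \<open>z j\<close> to \<open>z i\<close>
        replaces the coefficient \<open>r j\<close> by its remainder modulo \<open>r i\<close>;
        minimality forces this remainder to vanish.\<close>
      let ?q = "\<lambda>k. if k = j then q else 0"
      let ?z = "z(i := z i \<otimes> lin (I - {i}) ?q z)" and ?r = "\<lambda>k. if k = i then r i else r k - r i * ?q k"
      have "lin I ?r ?z = lin I r z"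
        unfolding lin_shear[OF Suc.prems(1) i(1) z(1)] using z(1) by (intro lin_cong) auto
      moreover have "z \<in> I - {i} \<rightarrow> carrier G" using z(1) by auto
      then have "?z \<in> I \<rightarrow> carrier G" using z(1) i(1) by (auto simp: Pi_iff)
      ultimately have "?r j \<noteq> 0 \<Longrightarrow> P (?z, ?r, j)"
        unfolding P_def using z that span_shear[OF Suc.prems(1) i(1) z(1)] by auto
      then have "?r j \<noteq> 0 \<Longrightarrow> size (r i) \<le> size (?r j)" by (rule min)
      then have "r j - r i * q = 0" using q False by (cases "r j - r i * q = 0") auto
      then show ?thesis by simp
    qed simp
    then have "\<forall>j\<in>I. \<exists>q. r j = r i * q" by (auto simp: dvd_def)
    from bchoice[OF this] obtain q where q: "\<And>j. j \<in> I \<Longrightarrow> r j = r i * q j" by blast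
    \<comment> \<open>All quotients are moved into \<open>w i\<close> at once: as
      \<open>r j = r i * q j\<close>, the whole relation becomes \<open>r i\<close> applied to
      \<open>w i\<close>.\<close>
    define w where "w = z(i := z i \<otimes> lin (I - {i}) q z)"
    have wI: "w \<in> I \<rightarrow> carrier G"
    proof -
      have "z \<in> I - {i} \<rightarrow> carrier G" using z(1) by auto
      then show ?thesis using z(1) i(1) by (auto simp: w_def Pi_iff)
    qed
    have ws: "span I w = span I y"
      using span_shear[OF Suc.prems(1) i(1) z(1)] z(2) by (simp add: w_def)
    have kill: "r i \<cdot> w i = \<one>"
    proof -
      let ?e = "\<lambda>j. if j = i then r i else 0"
      have "lin I ?e w = lin I r z"
        unfolding w_def lin_shear[OF Suc.prems(1) i(1) z(1)] using z(1) by (intro lin_cong) (auto simp: q[symmetric])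
      moreover have "lin (I - {i}) ?e w = \<one>"
        using wI by (intro lin_zero) (auto simp: Pi_iff)
      moreover have "r i \<cdot> w i \<in> carrier G" using wI i(1) by auto
      ultimately show ?thesis
        using z(3) lin_remove[OF Suc.prems(1) i(1) wI, of ?e] by simp
    qed
    have "n = card (I - {i})" "finite (I - {i})" "w \<in> I - {i} \<rightarrow> carrier G"
      using Suc.hyps(2) Suc.prems(1) i(1) wI by auto
    from Suc.hyps(1)[OF this] obtain y' c where
      y': "y' \<in> I - {i} \<rightarrow> carrier G" "span (I - {i}) y' = span (I - {i}) w"
      and c: "\<forall>j\<in>I - {i}. c j \<cdot> y' j = \<one>"
      and rel: "\<And>s. lin (I - {i}) s y' = \<one> \<Longrightarrow> (\<forall>j\<in>I - {i}. c j dvd s j)"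
      by blast
    \<comment> \<open>\<open>w i\<close> is kept, and the other generators are replaced by those of
      the induction hypothesis. The total span is unchanged because it depends on the others only
      through their span.\<close>
    define v where "v = y'(i := w i)"
    have vI: "v \<in> I \<rightarrow> carrier G"
      using y'(1) wI i(1) by (auto simp: v_def Pi_iff)
    have lin': "lin (I - {i}) s v = lin (I - {i}) s y'" for s
      using y'(1) by (intro lin_cong) (auto simp: v_def Pi_iff)
    then have "span (I - {i}) v = span (I - {i}) w"
      using y'(2) by (simp add: span_def)
    then have vs: "span I v = span I y"
      unfolding ws[symmetric] span_remove[OF Suc.prems(1) i(1) vI] span_remove[OF Suc.prems(1) i(1) wI]
      by (simp add: v_def)
    show ?thesis
    proof (rule exI[of _ v], rule exI[of _ "c(i := r i)"], intro conjI)
      show "\<forall>j\<in>I. (c(i := r i)) j \<cdot> v j = \<one>"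
        using c kill by (auto simp: v_def)
      show "\<forall>s. lin I s v = \<one> \<longrightarrow> (\<forall>j\<in>I. (c(i := r i)) j dvd s j)"
      proof (intro allI impI)
        fix s assume s: "lin I s v = \<one>"
        obtain q where q: "size (s i - r i * q) < size (r i)"
          using euclid i(2) by blast
        \<comment> \<open>Since \<open>r i\<close> annihilates \<open>w i\<close>, reducing the
          coefficient at \<open>i\<close> modulo \<open>r i\<close> keeps \<open>s\<close> a
          relation. The reduced coefficient has smaller size than \<open>r i\<close>, hence is zero
          by minimality.\<close>
        let ?s = "s(i := s i - r i * q)"
        have vi: "v i \<in> carrier G" "v i = w i"
          using funcset_mem[OF vI i(1)] by (auto simp: v_def)
        have "(r i * q) \<cdot> v i = q \<cdot> r i \<cdot> w i"
          using vi smult_mult[of "v i" q "r i"] by (simp only: mult.commute)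
        then have *: "s i \<cdot> v i = (s i - r i * q) \<cdot> v i"
          using smult_add[OF vi(1), of "s i - r i * q" "r i * q"] vi kill by simp
        moreover have "lin (I - {i}) ?s v = lin (I - {i}) s v"
          using vI by (intro lin_cong) auto
        ultimately have "lin I ?s v = \<one>"
          using s lin_remove[OF Suc.prems(1) i(1) vI, of ?s] lin_remove[OF Suc.prems(1) i(1) vI, of s]
          by (simp only: fun_upd_same)
        then have "?s i \<noteq> 0 \<Longrightarrow> P (v, ?s, i)"
          unfolding P_def using vI vs i by auto
        then have "?s i \<noteq> 0 \<Longrightarrow> size (r i) \<le> size (?s i)" by (rule min)
        then have 0: "s i - r i * q = 0" using q by (cases "s i - r i * q = 0") auto
        with * vi have "s i \<cdot> v i = \<one>" by simp
        moreover have "lin (I - {i}) s y' \<in> carrier G" using y'(1) by (rule lin_closed)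
        ultimately have "lin (I - {i}) s y' = \<one>"
          using s lin_remove[OF Suc.prems(1) i(1) vI, of s] lin'[of s] by simp
        then have "\<forall>j\<in>I - {i}. c j dvd s j" by (rule rel)
        then show "\<forall>j\<in>I. (c(i := r i)) j dvd s j"
          using 0 by auto
      qed
    qed (use vI vs in auto)
  qed
qed

lemma smult_uminus: "x \<in> carrier G \<Longrightarrow> (- r) \<cdot> x = inv (r \<cdot> x)"
  using smult_add[of x "- r" r] by (simp add: inv_equality)

lemma subgroup_span:
  assumes "finite I" "y \<in> I \<rightarrow> carrier G"
  shows "subgroup (span I y) G"
proof (rule subgroupI)
  show "span I y \<subseteq> carrier G" "span I y \<noteq> {}"
    using assms(2) by (auto simp: span_def)
  fix a assume "a \<in> span I y"
  then obtain r where r: "a = lin I r y" by (auto simp: span_def)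
  then have "inv a = lin I (\<lambda>j. (- 1) * r j) y"
    using assms smult_uminus[of a 1] lin_smult[OF assms, of "- 1" r] by simp
  then show "inv a \<in> span I y" by (auto simp: span_def)
  fix b assume "b \<in> span I y"
  then obtain s where "b = lin I s y" by (auto simp: span_def)
  then have "a \<otimes> b = lin I (\<lambda>j. r j + s j) y" using r assms(2) by (simp add: lin_add)
  then show "a \<otimes> b \<in> span I y" by (auto simp: span_def)
qed

lemma span_superset:
  assumes "finite I" "y \<in> I \<rightarrow> carrier G" "i \<in> I"
  shows "y i \<in> span I y"
proof -
  let ?e = "\<lambda>j. if j = i then 1 else 0"
  have "lin (I - {i}) ?e y = \<one>"
    using assms by (intro lin_zero) (auto simp: Pi_iff)
  then have "lin I ?e y = y i"
    using lin_remove[OF assms(1,3,2), of ?e] funcset_mem[OF assms(2,3)] by simp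
  then show ?thesis unfolding span_def by (metis rangeI)
qed

lemma subgroup_cyclic: "x \<in> carrier G \<Longrightarrow> subgroup (range (\<lambda>r. r \<cdot> x)) G"
  by (rule subgroupI) (auto simp flip: smult_uminus smult_add)

end

subsection \<open>Products of groups\<close>

lemma DirProd_assoc_iso: "(G \<times>\<times> H) \<times>\<times> K \<cong> G \<times>\<times> (H \<times>\<times> K)"
  by (rule is_isoI[of "\<lambda>((x, y), z). (x, (y, z))"])
    (auto simp: iso_def hom_def inj_on_def bij_betw_def image_iff)

lemma DirProd_trivial_left:
  assumes "group T" "carrier T = {\<one>\<^bsub>T\<^esub>}"
  shows "G \<cong> T \<times>\<times> G"
  using assms(2) monoid.l_one[OF group.is_monoid[OF assms(1)]] monoid.one_closed[OF group.is_monoid[OF assms(1)]]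
  by (intro is_isoI[of "\<lambda>x. (\<one>\<^bsub>T\<^esub>, x)"])
    (auto simp: iso_def hom_def inj_on_def bij_betw_def image_iff)

lemma product_group_Un_iso:
  assumes "I \<inter> J = {}"
  shows "product_group (I \<union> J) G \<cong> product_group I G \<times>\<times> product_group J G"
proof (rule is_isoI[of "\<lambda>x. (restrict x I, restrict x J)"], rule isoI)
  show "(\<lambda>x. (restrict x I, restrict x J)) \<in> hom (product_group (I \<union> J) G) (product_group I G \<times>\<times> product_group J G)"
    by (rule homI) (auto simp: fun_eq_iff)
  show "bij_betw (\<lambda>x. (restrict x I, restrict x J)) (carrier (product_group (I \<union> J) G))
     (carrier (product_group I G \<times>\<times> product_group J G))"
    using assms
    by (intro bij_betw_byWitness[where f' = "\<lambda>(x, y) i. if i \<in> I then x i else if i \<in> J then y i else undefined"])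
      (auto simp: fun_eq_iff PiE_iff extensional_def split: if_splits)
qed

lemma product_group_singleton_iso: "product_group {i} G \<cong> G i"
proof (rule is_isoI[of "\<lambda>x. x i"], rule isoI)
  show "(\<lambda>x. x i) \<in> hom (product_group {i} G) (G i)"
    by (rule homI) auto
  show "bij_betw (\<lambda>x. x i) (carrier (product_group {i} G)) (carrier (G i))"
    by (intro bij_betw_byWitness[where f' = "\<lambda>x. \<lambda>j\<in>{i}. x"])
      (auto simp: fun_eq_iff PiE_iff extensional_def split: if_splits)
qed

text \<open>If all factors outside a finite set are trivial, finite support is automatic. This turns
  the sum over \<open>{1..}\<close> in the theorem into a finite product.\<close>

lemma product_group_subset_iso_sum_group:
  assumes "finite J" "J \<subseteq> I" "\<And>i. i \<in> I \<Longrightarrow> group (G i)" "\<And>i. i \<in> I - J \<Longrightarrow> carrier (G i) = {\<one>\<^bsub>G i\<^esub>}"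
  shows "sum_group I G \<cong> product_group J G"
proof (rule is_isoI[of "\<lambda>x. restrict x J"], rule isoI)
  show "(\<lambda>x. restrict x J) \<in> hom (sum_group I G) (product_group J G)"
    using assms(2) by (intro homI) (auto simp: fun_eq_iff carrier_sum_group[OF assms(3)] subset_iff)
  have fin: "finite {i \<in> I. x i \<noteq> \<one>\<^bsub>G i\<^esub>}" if "\<And>i. i \<in> I - J \<Longrightarrow> x i = \<one>\<^bsub>G i\<^esub>" for x
    using that by (intro finite_subset[OF _ assms(1)]) auto
  have one: "\<one>\<^bsub>G i\<^esub> = x i" if "\<forall>i\<in>I. x i \<in> carrier (G i)" "i \<in> I" "i \<notin> J" for x i
    using that assms(4)[of i] by auto
  have [simp]: "\<one>\<^bsub>G i\<^esub> \<in> carrier (G i)" if "i \<in> I" for i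
    using assms(3)[OF that] by (simp add: group.is_monoid)
  show "bij_betw (\<lambda>x. restrict x J) (carrier (sum_group I G)) (carrier (product_group J G))"
    using assms(2)
    by (intro bij_betw_byWitness[where f' = "\<lambda>x. \<lambda>i\<in>I. if i \<in> J then x i else \<one>\<^bsub>G i\<^esub>"])
      (auto simp: fun_eq_iff PiE_iff extensional_def carrier_sum_group[OF assms(3)] subset_iff
         intro!: fin simp: one split: if_splits)
qed

subsection \<open>Isomorphism types of finite sums of cyclic groups\<close>

text \<open>Order 0 stands for the integers, as \<open>integer_mod_group 0\<close> is
  \<open>integer_group\<close>. The multiset is a description, not an invariant: a group may have
  several types, but groups with a common type are isomorphic.\<close>

definition has_cyclic_type :: "('a, 'b) monoid_scheme \<Rightarrow> nat multiset \<Rightarrow> bool"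
  where "has_cyclic_type G N \<longleftrightarrow>
    group G \<and> (\<exists>ns. mset ns = N \<and> DirProd_list (map integer_mod_group ns) \<cong> G)"

abbreviation cyclic_list :: "nat list \<Rightarrow> int list monoid"
  where "cyclic_list ns \<equiv> DirProd_list (map integer_mod_group ns)"

lemma group_cyclic_list [simp]: "group (cyclic_list ns)"
  by (rule DirProd_list_is_group) simp

lemma cyclic_list_Cons: "integer_mod_group n \<times>\<times> cyclic_list ns \<cong> cyclic_list (n # ns)"
  using DirProd_list_iso by (auto intro!: is_isoI)

lemma cyclic_list_Cons': "cyclic_list (n # ns) \<cong> integer_mod_group n \<times>\<times> cyclic_list ns"
  by (intro group.iso_sym[OF _ cyclic_list_Cons] DirProd_group) simp_all

lemma carrier_DirProd_list_Nil [simp]: "carrier (DirProd_list []) = {\<one>\<^bsub>DirProd_list []\<^esub>}"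
  by (simp add: DirProd_list_def)

lemma cyclic_list_append: "cyclic_list ms \<times>\<times> cyclic_list ns \<cong> cyclic_list (ms @ ns)"
proof (induction ms)
  case Nil
  have "cyclic_list ns \<cong> cyclic_list [] \<times>\<times> cyclic_list ns"
    by (rule DirProd_trivial_left[OF group_cyclic_list]) simp
  then show ?case by (simp add: group.iso_sym)
next
  case (Cons m ms)
  have "cyclic_list (m # ms) \<times>\<times> cyclic_list ns \<cong> (integer_mod_group m \<times>\<times> cyclic_list ms) \<times>\<times> cyclic_list ns"
    by (intro group.DirProd_iso_trans[OF group_cyclic_list] cyclic_list_Cons' iso_refl)
  also have "\<dots> \<cong> integer_mod_group m \<times>\<times> (cyclic_list ms \<times>\<times> cyclic_list ns)"
    by (rule DirProd_assoc_iso)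
  also have "\<dots> \<cong> integer_mod_group m \<times>\<times> cyclic_list (ms @ ns)"
    by (intro group.DirProd_iso_trans[OF group_integer_mod_group] Cons iso_refl)
  also have "\<dots> \<cong> cyclic_list (m # ms @ ns)"
    by (rule cyclic_list_Cons)
  finally show ?case by simp
qed

text \<open>The head of one list is located in the other, and the two blocks meeting there are
  swapped. Thus commutativity of binary products yields every permutation.\<close>

lemma cyclic_list_perm: "mset ms = mset ns \<Longrightarrow> cyclic_list ms \<cong> cyclic_list ns"
proof (induction ms arbitrary: ns)
  case (Cons m ms)
  then have "m \<in> set ns" by (metis list.set_intros(1) mset_eq_setD)
  then obtain as bs where ns: "ns = as @ m # bs" by (meson split_list)
  with Cons.prems have "mset ms = mset (bs @ as)" by simp
  have "cyclic_list (m # ms) \<cong> integer_mod_group m \<times>\<times> cyclic_list ms"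
    by (rule cyclic_list_Cons')
  also have "\<dots> \<cong> integer_mod_group m \<times>\<times> cyclic_list (bs @ as)"
    by (intro group.DirProd_iso_trans[OF group_integer_mod_group] Cons iso_refl \<open>mset ms = mset (bs @ as)\<close>)
  also have "\<dots> \<cong> cyclic_list ((m # bs) @ as)"
    using cyclic_list_Cons[of m "bs @ as"] by simp
  also have "\<dots> \<cong> cyclic_list (m # bs) \<times>\<times> cyclic_list as"
    by (intro group.iso_sym[OF _ cyclic_list_append] DirProd_group group_cyclic_list)
  also have "\<dots> \<cong> cyclic_list as \<times>\<times> cyclic_list (m # bs)"
    by (rule DirProd_commute_iso)
  also have "\<dots> \<cong> cyclic_list ns"
    unfolding ns by (rule cyclic_list_append)
  finally show ?case .
qed simp

lemma has_cyclic_type_group: "has_cyclic_type G N \<Longrightarrow> group G"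
  by (simp add: has_cyclic_type_def)

lemma has_cyclic_type_iso:
  "\<lbrakk>has_cyclic_type G N; G \<cong> H; group H\<rbrakk> \<Longrightarrow> has_cyclic_type H N"
  unfolding has_cyclic_type_def using iso_trans by blast

lemma has_cyclic_type_unique:
  assumes "has_cyclic_type G N" "has_cyclic_type H N"
  shows "G \<cong> H"
proof -
  obtain ms ns where ms: "mset ms = N" "cyclic_list ms \<cong> G" and ns: "mset ns = N" "cyclic_list ns \<cong> H"
    using assms unfolding has_cyclic_type_def by blast
  have "G \<cong> cyclic_list ms"
    using ms(2) by (rule group.iso_sym[OF group_cyclic_list])
  also have "\<dots> \<cong> cyclic_list ns"
    using ms ns by (intro cyclic_list_perm) simp
  also have "\<dots> \<cong> H" by (rule ns)
  finally show ?thesis .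
qed

lemma has_cyclic_type_DirProd:
  assumes "has_cyclic_type G M" "has_cyclic_type H N"
  shows "has_cyclic_type (G \<times>\<times> H) (M + N)"
proof -
  obtain ms ns where ms: "mset ms = M" "cyclic_list ms \<cong> G" and ns: "mset ns = N" "cyclic_list ns \<cong> H"
    using assms unfolding has_cyclic_type_def by blast
  have "cyclic_list (ms @ ns) \<cong> cyclic_list ms \<times>\<times> cyclic_list ns"
    by (intro group.iso_sym[OF _ cyclic_list_append] DirProd_group group_cyclic_list)
  also have "\<dots> \<cong> G \<times>\<times> H"
    by (intro group.DirProd_iso_trans[OF group_cyclic_list] ms ns)
  finally show ?thesis
    unfolding has_cyclic_type_def using ms ns has_cyclic_type_group[OF assms(1)] has_cyclic_type_group[OF assms(2)]
    by (auto intro!: DirProd_group exI[of _ "ms @ ns"])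
qed

lemma has_cyclic_type_trivial:
  assumes "group G" "carrier G = {\<one>\<^bsub>G\<^esub>}"
  shows "has_cyclic_type G {#}"
proof -
  have "cyclic_list [] \<cong> G"
    using assms by (intro is_isoI[of "\<lambda>_. \<one>\<^bsub>G\<^esub>"])
      (auto simp: iso_def hom_def bij_betw_def DirProd_list_def group.is_monoid)
  then show ?thesis
    unfolding has_cyclic_type_def using assms(1) by (auto intro!: exI[of _ "[]"])
qed

lemma has_cyclic_type_integer_mod_group: "has_cyclic_type (integer_mod_group n) {#n#}"
proof -
  have "cyclic_list [n] \<cong> integer_mod_group n \<times>\<times> cyclic_list []"
    by (rule cyclic_list_Cons')
  also have "\<dots> \<cong> cyclic_list [] \<times>\<times> integer_mod_group n"
    by (rule DirProd_commute_iso)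
  also have "\<dots> \<cong> integer_mod_group n"
    by (intro group.iso_sym[OF _ DirProd_trivial_left] group_cyclic_list group_integer_mod_group) simp
  finally show ?thesis
    unfolding has_cyclic_type_def by (auto intro!: exI[of _ "[n]"])
qed

text \<open>A group of type \<open>N\<close> is isomorphic to its product with
  \<open>integer_mod_group 1\<close>, which shares its type with \<open>G\<close>.\<close>

lemma has_cyclic_type_remove1:
  assumes "has_cyclic_type G (add_mset 1 N)"
  shows "has_cyclic_type G N"
proof -
  have triv: "carrier (integer_mod_group 1) = {\<one>\<^bsub>integer_mod_group 1\<^esub>}"
    by (auto simp: carrier_integer_mod_group)
  obtain ns where "mset ns = N" by (metis ex_mset)
  then have ns: "has_cyclic_type (cyclic_list ns) N"
    unfolding has_cyclic_type_def by (auto intro!: exI[of _ ns])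
  then have "has_cyclic_type (integer_mod_group 1 \<times>\<times> cyclic_list ns) (add_mset 1 N)"
    using has_cyclic_type_DirProd[OF has_cyclic_type_integer_mod_group[of 1] ns] by simp
  then have "integer_mod_group 1 \<times>\<times> cyclic_list ns \<cong> G"
    using assms by (rule has_cyclic_type_unique)
  with DirProd_trivial_left[OF group_integer_mod_group triv] have "cyclic_list ns \<cong> G"
    by (rule iso_trans)
  then show ?thesis
    by (rule has_cyclic_type_iso[OF ns _ has_cyclic_type_group[OF assms]])
qed

text \<open>Exponent 0 produces factors of order 1, for which the forms required in the theorem have
  no place.\<close>

lemma has_cyclic_type_filter:
  "has_cyclic_type G N \<Longrightarrow> has_cyclic_type G (filter_mset (\<lambda>n. n \<noteq> 1) N)"
proof (induction "count N 1" arbitrary: N)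
  case 0
  then have "filter_mset (\<lambda>n. n \<noteq> 1) N = N"
    by (auto simp: filter_mset_eq_conv count_eq_zero_iff)
  with 0 show ?case by simp
next
  case (Suc k)
  then have "1 \<in># N" by (metis count_eq_zero_iff nat.distinct(1))
  then obtain M where M: "N = add_mset 1 M" by (metis insert_DiffM)
  then have "has_cyclic_type G M" using Suc.prems has_cyclic_type_remove1 by blast
  then show ?case using Suc.hyps(1)[of M] Suc.hyps(2) M by simp
qed

lemma has_cyclic_type_product_group:
  assumes "finite I" "\<And>i. i \<in> I \<Longrightarrow> has_cyclic_type (G i) (N i)"
  shows "has_cyclic_type (product_group I G) (\<Sum>i\<in>I. N i)"
  using assms
proof (induction I)
  case empty
  show ?case by (simp only: sum.empty, rule has_cyclic_type_trivial[OF product_group]) auto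
next
  case (insert i I)
  have grp: "group (G j)" if "j \<in> insert i I" for j
    using insert.prems[OF that] by (rule has_cyclic_type_group)
  have "group (product_group {i} G)" by (rule product_group) (use grp in auto)
  have "has_cyclic_type (G i \<times>\<times> product_group I G) (N i + (\<Sum>i\<in>I. N i))"
    using insert by (intro has_cyclic_type_DirProd) auto
  moreover have "product_group (insert i I) G \<cong> product_group {i} G \<times>\<times> product_group I G"
    using product_group_Un_iso[of "{i}" I G] insert.hyps by simp
  then have "product_group (insert i I) G \<cong> G i \<times>\<times> product_group I G"
    by (rule iso_trans)
      (rule group.DirProd_iso_trans[OF \<open>group (product_group {i} G)\<close> product_group_singleton_iso iso_refl])
  then have "G i \<times>\<times> product_group I G \<cong> product_group (insert i I) G"
    by (rule group.iso_sym[rotated]) (intro product_group grp)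
  ultimately have "has_cyclic_type (product_group (insert i I) G) (N i + (\<Sum>i\<in>I. N i))"
    by (rule has_cyclic_type_iso) (intro product_group grp)
  then show ?case
    using insert.hyps by simp
qed

lemma has_cyclic_type_sum_group:
  assumes "finite J" "J \<subseteq> I" "\<And>i. i \<in> J \<Longrightarrow> has_cyclic_type (G i) (N i)"
    "\<And>i. i \<in> I \<Longrightarrow> group (G i)" "\<And>i. i \<in> I - J \<Longrightarrow> carrier (G i) = {\<one>\<^bsub>G i\<^esub>}"
  shows "has_cyclic_type (sum_group I G) (\<Sum>i\<in>J. N i)"
proof -
  have "sum_group I G \<cong> product_group J G"
    by (rule product_group_subset_iso_sum_group[OF assms(1,2,4,5)])
  then have "product_group J G \<cong> sum_group I G"
    by (rule group.iso_sym[OF sum_group[OF assms(4)], rotated])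
  then show ?thesis
    by (rule has_cyclic_type_iso[OF has_cyclic_type_product_group[OF assms(1,3)] _ sum_group[OF assms(4)], rotated])
qed

lemma has_cyclic_type_direct_power:
  "has_cyclic_type G N \<Longrightarrow> has_cyclic_type (direct_power G k) (repeat_mset k N)"
proof -
  assume "has_cyclic_type G N"
  then have "has_cyclic_type (direct_power G k) (\<Sum>i<k. N)"
    unfolding direct_power_def by (intro has_cyclic_type_product_group) auto
  moreover have "(\<Sum>i<k. N) = repeat_mset k N" by (induction k) auto
  ultimately show ?thesis by simp
qed

subsection \<open>Square roots of -1\<close>

text \<open>Euler's criterion gives a root modulo \<open>p\<close>, and Hensel lifting carries it
  from \<open>p ^ k\<close> to \<open>p ^ Suc k\<close>, the derivative \<open>2 * x\<close> being
  invertible modulo \<open>p\<close>.\<close>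

lemma sqrt_minus_one_mod_prime_power:
  assumes p: "Factorial_Ring.prime p" "[p = 1] (mod 4)"
  shows "\<exists>x::int. [x\<^sup>2 = -1] (mod int p ^ k)"
proof (induction k)
  case (Suc k)
  have p4: "p mod 4 = 1" using p(2) by (simp add: cong_def)
  have p2: "p > 2" using prime_ge_2_nat[OF p(1)] p4 by (cases "p = 2") auto
  show ?case
  proof (cases "k = 0")
    \<comment> \<open>The first step cannot be a lift: a root modulo 1 is arbitrary, whereas lifting
      needs \<open>p\<close> to divide \<open>x\<^sup>2 + 1\<close>.\<close>
    case True
    have "even ((p - 1) div 2)" using p4 p2 by presburger
    then have "[Legendre (-1) p = 1] (mod p)"
      using euler_criterion[OF p(1) p2, of "-1"] by simp
    moreover have "\<not> [-1 = 1] (mod int p)" "\<not> [0 = 1] (mod int p)"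
      using p2 by (auto simp: cong_iff_dvd_diff zdvd_not_zless)
    ultimately have "QuadRes p (-1)" by (auto simp: Legendre_def split: if_splits)
    then show ?thesis using True by (simp add: QuadRes_def)
  next
    case False
    obtain x where x: "[x\<^sup>2 = -1] (mod int p ^ k)" using Suc by blast
    then obtain c where c: "x\<^sup>2 + 1 = int p ^ k * c"
      by (auto simp: cong_iff_dvd_diff)
    have "coprime (2 * x) (int p)"
    proof -
      have "int p dvd x\<^sup>2 + 1" using c False by (simp add: dvd_power)
      then have "\<not> int p dvd x"
        using p2 by (metis dvd_add_right_iff dvd_power even_numeral int_dvd_int_iff nat_dvd_1_iff_1
            of_nat_1 order_less_irrefl pos2 dvd_trans one_less_numeral_iff semiring_norm(76) less_trans)
      moreover have "\<not> int p dvd 2" using p2 by (simp add: zdvd_not_zless)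
      ultimately have "\<not> int p dvd 2 * x"
        using p(1) by (simp add: prime_dvd_mult_iff)
      then show ?thesis
        using prime_imp_coprime[of "int p" "2 * x"] p(1) by (simp add: coprime_commute)
    qed
    then obtain y where y: "[2 * x * y = 1] (mod int p)" using cong_solve_coprime_int by blast
    have "[c - 2 * x * y * c = c - 1 * c] (mod int p)"
      by (intro cong_diff cong_mult y) auto
    then obtain d where d: "c - 2 * x * y * c = int p * d" by (auto simp: cong_iff_dvd_diff)
    \<comment> \<open>This is a Newton step: \<open>c\<close> is \<open>x\<^sup>2 + 1\<close>
      divided by \<open>p ^ k\<close> and \<open>y\<close> inverts \<open>2 * x\<close> modulo
      \<open>p\<close>, so the terms linear in \<open>p ^ k\<close> combine to a multiple of
      \<open>p ^ Suc k\<close>.\<close>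
    have "(x - int p ^ k * (y * c))\<^sup>2 + 1 = (x\<^sup>2 + 1) - int p ^ k * (2 * x * y * c) + int p ^ k * int p ^ k * (y * c)\<^sup>2"
      by (simp add: power2_eq_square algebra_simps)
    also have "\<dots> = int p ^ k * (int p * d) + int p ^ k * int p ^ k * (y * c)\<^sup>2"
      unfolding c d[symmetric] by (simp add: algebra_simps)
    also have "int p ^ Suc k dvd \<dots>"
    proof -
      have "int p dvd int p ^ k" using False by (simp add: dvd_power)
      then have "int p ^ k * int p dvd int p ^ k * int p ^ k * (y * c)\<^sup>2"
        by (intro dvd_mult2 mult_dvd_mono) auto
      then show ?thesis by (intro dvd_add) (auto simp: mult_ac)
    qed
    finally show ?thesis
      by (intro exI[of _ "x - int p ^ k * (y * c)"]) (simp add: cong_iff_dvd_diff)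
  qed
qed auto

text \<open>Otherwise \<open>a / b\<close> would be a square root of -1 modulo \<open>p\<close>,
  against Euler's criterion, since \<open>(p - 1) div 2\<close> is odd. By symmetry the same holds
  for \<open>a\<close>, which makes \<open>p\<close> prime in Z[i].\<close>

lemma prime_dvd_sum_squares:
  assumes p: "Factorial_Ring.prime p" "[p = 3] (mod 4)" and dvd: "int p dvd a\<^sup>2 + b\<^sup>2"
  shows "int p dvd b"
proof (rule ccontr)
  assume b: "\<not> int p dvd b"
  have p4: "p mod 4 = 3" using p(2) by (simp add: cong_def)
  have p2: "p > 2" using prime_ge_2_nat[OF p(1)] p4 by (cases "p = 2") auto
  have "coprime b (int p)"
    using prime_imp_coprime[of "int p" b] p(1) b by (simp add: coprime_commute)
  then obtain c where c: "[b * c = 1] (mod int p)" using cong_solve_coprime_int by blast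
  have "[(a * c)\<^sup>2 + (b * c)\<^sup>2 = 0] (mod int p)"
    using dvd_mult2[OF dvd, of "c\<^sup>2"] by (simp add: cong_0_iff algebra_simps)
  moreover have "[(b * c)\<^sup>2 = 1\<^sup>2] (mod int p)" by (intro cong_pow c)
  ultimately have "[(a * c)\<^sup>2 + (b * c)\<^sup>2 - (b * c)\<^sup>2 = 0 - 1\<^sup>2] (mod int p)" by (rule cong_diff)
  then have "QuadRes p (-1)" by (auto simp: QuadRes_def)
  moreover have "\<not> [-1 = 0] (mod int p)"
    using p2 by (auto simp: cong_iff_dvd_diff zdvd_not_zless)
  ultimately have "Legendre (-1) p = 1" by (simp add: Legendre_def)
  moreover have "odd ((p - 1) div 2)" using p4 p2 by presburger
  ultimately have "[1 = -1] (mod int p)"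
    using euler_criterion[OF p(1) p2, of "-1"] by simp
  then show False using p2 by (auto simp: cong_iff_dvd_diff zdvd_not_zless)
qed

subsection \<open>Gaussian integers\<close>

datatype gauss_int = Gauss (gre: int) (gim: int)

instantiation gauss_int :: comm_ring_1
begin

definition "0 = Gauss 0 0"
definition "1 = Gauss 1 0"
definition "z + w = Gauss (gre z + gre w) (gim z + gim w)"
definition "z - w = Gauss (gre z - gre w) (gim z - gim w)"
definition "- z = Gauss (- gre z) (- gim z)"
definition "z * w = Gauss (gre z * gre w - gim z * gim w) (gre z * gim w + gim z * gre w)"

instance
  by standard
    (auto simp: zero_gauss_int_def one_gauss_int_def plus_gauss_int_def minus_gauss_int_def
      uminus_gauss_int_def times_gauss_int_def algebra_simps)

end

lemmas gauss_int_defs = zero_gauss_int_def one_gauss_int_def plus_gauss_int_def minus_gauss_int_def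
  uminus_gauss_int_def times_gauss_int_def

definition gnorm :: "gauss_int \<Rightarrow> int"
  where "gnorm z = (gre z)\<^sup>2 + (gim z)\<^sup>2"

definition gcnj :: "gauss_int \<Rightarrow> gauss_int"
  where "gcnj z = Gauss (gre z) (- gim z)"

lemma gnorm_mult: "gnorm (z * w) = gnorm z * gnorm w"
  by (simp add: gnorm_def gauss_int_defs power2_eq_square algebra_simps)

lemma gnorm_nonneg: "gnorm z \<ge> 0"
  by (simp add: gnorm_def)

lemma gnorm_eq_0_iff: "gnorm z = 0 \<longleftrightarrow> z = 0"
  by (cases z) (simp add: gnorm_def zero_gauss_int_def)

lemma mult_gcnj: "z * gcnj z = Gauss (gnorm z) 0"
  by (simp add: gnorm_def gcnj_def gauss_int_defs power2_eq_square)

lemma gnorm_gcnj: "gnorm (gcnj z) = gnorm z"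
  by (simp add: gnorm_def gcnj_def)

instance gauss_int :: idom
  by standard (metis gnorm_eq_0_iff gnorm_mult mult_eq_0_iff)

lemma Gauss_dvd_iff: "Gauss n 0 dvd z \<longleftrightarrow> n dvd gre z \<and> n dvd gim z"
proof
  assume "n dvd gre z \<and> n dvd gim z"
  then obtain a b where "gre z = n * a" "gim z = n * b" by (auto simp: dvd_def)
  then have "z = Gauss n 0 * Gauss a b" by (cases z) (simp add: gauss_int_defs)
  then show "Gauss n 0 dvd z" by (rule dvdI)
qed (auto simp: dvd_def gauss_int_defs)

lemma Gauss_power: "Gauss n 0 ^ k = Gauss (n ^ k) 0"
  by (induction k) (simp_all add: gauss_int_defs)

text \<open>The quotient is the exact one, \<open>r * gcnj s\<close> divided by the norm of
  \<open>s\<close>, with coordinates rounded to nearest integers. Each coordinate errs by at most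
  1/2, so the remainder has at most half the norm of \<open>s\<close>.\<close>

lemma gauss_int_euclid:
  assumes "s \<noteq> 0"
  shows "\<exists>q. nat (gnorm (r - s * q)) < nat (gnorm s)"
proof -
  define n where "n = gnorm s"
  have n: "n > 0" using assms gnorm_eq_0_iff[of s] gnorm_nonneg[of s] by (auto simp: n_def)
  have round: "\<exists>a. (2 * (u - n * a))\<^sup>2 \<le> n\<^sup>2" for u
  proof -
    \<comment> \<open>This is \<open>u / n + 1/2\<close> rounded down, the integer nearest to
      \<open>u / n\<close>.\<close>
    let ?a = "(2 * u + n) div (2 * n)"
    have "2 * n * ?a + (2 * u + n) mod (2 * n) = 2 * u + n" by simp
    moreover have "0 \<le> (2 * u + n) mod (2 * n)" "(2 * u + n) mod (2 * n) < 2 * n" using n by simp_all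
    ultimately have "\<bar>2 * (u - n * ?a)\<bar> \<le> n" by (simp add: algebra_simps abs_le_iff)
    then show ?thesis by (metis abs_le_square_iff abs_of_pos n)
  qed
  define t where "t = r * gcnj s"
  obtain a b where a: "(2 * (gre t - n * a))\<^sup>2 \<le> n\<^sup>2" and b: "(2 * (gim t - n * b))\<^sup>2 \<le> n\<^sup>2"
    using round by blast
  let ?q = "Gauss a b"
  have "(r - s * ?q) * gcnj s = t - (s * gcnj s) * ?q"
    by (simp add: t_def algebra_simps)
  also have "\<dots> = Gauss (gre t - n * a) (gim t - n * b)"
    unfolding mult_gcnj n_def[symmetric] by (simp add: gauss_int_defs)
  finally have "gnorm (r - s * ?q) * n = (gre t - n * a)\<^sup>2 + (gim t - n * b)\<^sup>2"
    by (metis gnorm_def gnorm_gcnj gnorm_mult gauss_int.sel n_def)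
  moreover have "4 * (gre t - n * a)\<^sup>2 \<le> n\<^sup>2" "4 * (gim t - n * b)\<^sup>2 \<le> n\<^sup>2"
    using a b unfolding power_mult_distrib by simp_all
  ultimately have "4 * (gnorm (r - s * ?q) * n) \<le> 2 * n\<^sup>2"
    by linarith
  moreover have "n\<^sup>2 > 0" using n by simp
  ultimately have "gnorm (r - s * ?q) * n < n * n" by (simp only: power2_eq_square)
  then have "gnorm (r - s * ?q) < n" using n by simp
  then show ?thesis unfolding n_def using gnorm_nonneg by (metis n n_def nat_less_eq_zless)
qed

text \<open>Norms reduce the question to primality in the integers: if \<open>p\<close> divides the
  norm of a factor, then it divides both coordinates of that factor.\<close>

lemma prime_elem_Gauss:
  assumes "Factorial_Ring.prime p" "[p = 3] (mod 4)"
  shows "prime_elem (Gauss (int p) 0)"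
proof -
  have *: "Gauss (int p) 0 dvd z" if "int p dvd gnorm z" for z
    using prime_dvd_sum_squares[OF assms] that unfolding gnorm_def Gauss_dvd_iff by (metis add.commute)
  have p: "Factorial_Ring.prime (int p)" using assms(1) by simp
  show ?thesis
  proof (rule prime_elemI)
    show "Gauss (int p) 0 \<noteq> 0" "\<not> Gauss (int p) 0 dvd 1"
      using assms(1) prime_gt_1_nat[OF assms(1)] by (auto simp: Gauss_dvd_iff gauss_int_defs)
    fix z w assume "Gauss (int p) 0 dvd z * w"
    then obtain v where v: "z * w = Gauss (int p) 0 * v" by (elim dvdE)
    have "gnorm z * gnorm w = gnorm (Gauss (int p) 0) * gnorm v"
      using v by (metis gnorm_mult)
    then have "int p dvd gnorm z * gnorm w" by (simp add: gnorm_def power2_eq_square)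
    then show "Gauss (int p) 0 dvd z \<or> Gauss (int p) 0 dvd w"
      using p * by (auto simp: prime_dvd_mult_iff)
  qed
qed

text \<open>Modulo 1 + i one has i = -1 and 2 = 0, so the class of \<open>z\<close> is the parity of
  its coordinate sum.\<close>

lemma one_plus_i_dvd_iff: "Gauss 1 1 dvd z \<longleftrightarrow> even (gre z + gim z)"
proof
  assume "even (gre z + gim z)"
  then obtain c where "gre z + gim z = 2 * c" by (elim evenE)
  then have "z = Gauss 1 1 * Gauss c (gim z - c)" by (cases z) (simp add: gauss_int_defs)
  then show "Gauss 1 1 dvd z" by (rule dvdI)
qed (auto simp: dvd_def gauss_int_defs)

lemma prime_elem_one_plus_i: "prime_elem (Gauss 1 1)"
  by (rule prime_elemI) (auto simp: one_plus_i_dvd_iff gauss_int_defs)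

text \<open>In the basis 1, 1 + i the ideal of \<open>Gauss 1 1 ^ n\<close> is diagonal, which
  exhibits the quotient as a sum of two cyclic groups. Each division by 1 + i exchanges the roles of
  the two coordinates, whence the alternating exponents.\<close>

lemma one_plus_i_power_dvd_iff:
  "Gauss 1 1 ^ n dvd Gauss a 0 + Gauss 1 1 * Gauss b 0 \<longleftrightarrow> 2 ^ (Suc n div 2) dvd a \<and> 2 ^ (n div 2) dvd b"
proof (induction n arbitrary: a b)
  case (Suc n)
  show ?case
  proof (cases "even a")
    case True
    then obtain c where c: "a = 2 * c" by (elim evenE)
    \<comment> \<open>Here 2 divided by 1 + i is 1 - i, that is 2 - (1 + i).\<close>
    have "Gauss a 0 + Gauss 1 1 * Gauss b 0 = Gauss 1 1 * (Gauss (b + 2 * c) 0 + Gauss 1 1 * Gauss (- c) 0)"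
      by (simp add: gauss_int_defs c)
    then have "Gauss 1 1 ^ Suc n dvd Gauss a 0 + Gauss 1 1 * Gauss b 0 \<longleftrightarrow>
        Gauss 1 1 ^ n dvd Gauss (b + 2 * c) 0 + Gauss 1 1 * Gauss (- c) 0"
      by (simp only: power_Suc dvd_mult_cancel_left) (simp add: zero_gauss_int_def)
    also have "\<dots> \<longleftrightarrow> 2 ^ (Suc n div 2) dvd b + 2 * c \<and> 2 ^ (n div 2) dvd c"
      unfolding Suc by simp
    also have "\<dots> \<longleftrightarrow> 2 ^ (Suc n div 2) dvd b \<and> 2 ^ (n div 2) dvd c"
    proof -
      \<comment> \<open>The summand \<open>2 * c\<close> has a factor 2 to spare, which suffices as
        \<open>Suc n div 2\<close> exceeds \<open>n div 2\<close> by at most 1.\<close>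
      have "2 ^ (Suc n div 2) dvd 2 * c" if "2 ^ (n div 2) dvd c"
      proof -
        have "(2::int) ^ (Suc n div 2) dvd 2 ^ Suc (n div 2)" by (intro le_imp_power_dvd) linarith
        also have "\<dots> dvd 2 * c" using that by simp
        finally show ?thesis .
      qed
      then show ?thesis by (metis dvd_add_left_iff)
    qed
    finally show ?thesis by (simp add: c conj_commute)
  next
    case False
    then have "\<not> Gauss 1 1 dvd Gauss a 0 + Gauss 1 1 * Gauss b 0"
      by (simp add: one_plus_i_dvd_iff gauss_int_defs)
    then have "\<not> Gauss 1 1 ^ Suc n dvd Gauss a 0 + Gauss 1 1 * Gauss b 0"
      by (metis dvd_mult_left power_Suc)
    moreover have "\<not> 2 ^ (Suc (Suc n) div 2) dvd a"
      using False by (auto dest: dvd_mult_left)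
    ultimately show ?thesis by blast
  qed
qed simp

text \<open>Each factor \<open>q\<close> of \<open>c * d = q ^ Suc n\<close> lies in
  \<open>c\<close> or in \<open>d\<close> and is cancelled there, until a divisor of 1 is left of
  \<open>c\<close>. This identifies the annihilator of a generator killed by a power of
  \<open>q\<close>.\<close>

lemma dvd_prime_elem_power_cases:
  fixes q :: "'r::idom"
  assumes "prime_elem q" "c dvd q ^ n"
  obtains k u where "c = q ^ k * u" "u dvd 1"
proof -
  have "\<exists>k u. c = q ^ k * u \<and> u dvd 1"
    using assms(2)
  proof (induction n arbitrary: c)
    case 0
    then show ?case by (intro exI[of _ 0] exI[of _ c]) simp
  next
    case (Suc n)
    from Suc.prems obtain d where "q ^ Suc n = c * d" by (elim dvdE)
    then have d: "q * q ^ n = c * d" by simp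
    then have "q dvd c * d" by (metis dvd_triv_left)
    then consider "q dvd c" | "q dvd d" using assms(1) by (auto simp: prime_elem_dvd_mult_iff)
    then show ?case
    proof cases
      case 1
      then obtain e where e: "c = q * e" by (elim dvdE)
      then have "q ^ n = e * d" using d assms(1) by (simp add: mult.assoc)
      then obtain k u where "e = q ^ k * u" "u dvd 1" using Suc.IH[of e] by auto
      then show ?thesis using e by (intro exI[of _ "Suc k"] exI[of _ u]) (simp add: mult.assoc)
    next
      case 2
      then obtain e where e: "d = q * e" by (elim dvdE)
      then have "q ^ n = c * e" using d assms(1) by (simp add: mult.left_commute)
      then show ?thesis using Suc.IH[of c] by auto
    qed
  qed
  then show ?thesis using that by blast
qed

subsection \<open>Complex structures\<close>

text \<open>The map is multiplication by i. Bijectivity is automatic, because composing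
  \<open>f\<close> with itself gives inversion.\<close>

definition complex_structure :: "('a, 'b) monoid_scheme \<Rightarrow> ('a \<Rightarrow> 'a) \<Rightarrow> bool"
  where "complex_structure G f \<longleftrightarrow>
    comm_group G \<and> f \<in> hom G G \<and> (\<forall>x\<in>carrier G. f (f x) = inv\<^bsub>G\<^esub> x)"

definition gact :: "('a, 'b) monoid_scheme \<Rightarrow> ('a \<Rightarrow> 'a) \<Rightarrow> gauss_int \<Rightarrow> 'a \<Rightarrow> 'a"
  where "gact G f r x = x [^]\<^bsub>G\<^esub> gre r \<otimes>\<^bsub>G\<^esub> f x [^]\<^bsub>G\<^esub> gim r"

lemma complex_structureD:
  assumes "complex_structure G f"
  shows "comm_group G" "group G" "f \<in> hom G G" "x \<in> carrier G \<Longrightarrow> f x \<in> carrier G"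
    "x \<in> carrier G \<Longrightarrow> f (f x) = inv\<^bsub>G\<^esub> x"
  using assms by (auto simp: complex_structure_def comm_group_def dest: hom_in_carrier)

lemma euclidean_action_gact:
  fixes G (structure)
  assumes "complex_structure G f"
  shows "euclidean_action G (gact G f) (\<lambda>z. nat (gnorm z))"
proof -
  interpret comm_group G using assms by (rule complex_structureD)
  note [simp] = complex_structureD(4,5)[OF assms]
  have f_pow: "f (x [^] k) = f x [^] k" if "x \<in> carrier G" for x and k :: int
    by (rule hom_int_pow[OF complex_structureD(3)[OF assms] that is_group is_group])
  have f_mult: "f (x \<otimes> y) = f x \<otimes> f y" if "x \<in> carrier G" "y \<in> carrier G" for x y
    using complex_structureD(3)[OF assms] that by (rule hom_mult)
  show ?thesis
  proof
    fix x r s assume x: "x \<in> carrier G"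
    show "gact G f r x \<in> carrier G" using x by (simp add: gact_def)
    show "gact G f (r + s) x = gact G f r x \<otimes> gact G f s x"
      using x by (simp add: gact_def plus_gauss_int_def int_pow_mult m_ac)
    show "gact G f 1 x = x"
      using x by (simp add: gact_def one_gauss_int_def)
    have "gact G f r (gact G f s x) =
        (x [^] (gre s * gre r) \<otimes> f x [^] (gim s * gre r)) \<otimes> (f x [^] (gre s * gim r) \<otimes> inv x [^] (gim s * gim r))"
      using x by (simp add: gact_def f_mult f_pow int_pow_distrib int_pow_pow)
    also have "inv x [^] (gim s * gim r) = x [^] (- (gim s * gim r))"
      using x by (simp add: int_pow_inv int_pow_neg)
    finally show "gact G f (r * s) x = gact G f r (gact G f s x)"
      using x by (simp add: gact_def times_gauss_int_def int_pow_mult[symmetric] m_ac)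
        (simp add: int_pow_mult diff_conv_add_uminus m_ac mult.commute del: add_uminus_conv_diff)
  next
    fix x y r assume "x \<in> carrier G" "y \<in> carrier G"
    then show "gact G f r (x \<otimes> y) = gact G f r x \<otimes> gact G f r y"
      by (simp add: gact_def f_mult int_pow_distrib m_ac)
  next
    fix r s :: gauss_int assume "s \<noteq> 0"
    then show "\<exists>q. nat (gnorm (r - s * q)) < nat (gnorm s)" by (rule gauss_int_euclid)
  qed
qed

lemma complex_structure_subgroup:
  assumes "complex_structure G f" "subgroup H G" "\<And>x. x \<in> H \<Longrightarrow> f x \<in> H"
  shows "complex_structure (G\<lparr>carrier := H\<rparr>) f"
proof -
  interpret comm_group G using assms(1) by (rule complex_structureD)
  have "x \<in> H \<Longrightarrow> x \<in> carrier G" for x using assms(2) by (rule subgroup.mem_carrier)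
  moreover have "comm_group (G\<lparr>carrier := H\<rparr>)"
    using \<open>\<And>x. x \<in> H \<Longrightarrow> x \<in> carrier G\<close>
    by (intro group.group_comm_groupI subgroup.subgroup_is_group[OF assms(2) is_group]) (simp add: m_comm)
  ultimately show ?thesis
    using assms hom_mult[OF complex_structureD(3)[OF assms(1)]]
    by (auto simp: complex_structure_def hom_def)
qed

lemma complex_structure_iso:
  assumes "complex_structure G f" "G \<cong> H" "group H"
  shows "\<exists>g. complex_structure H g"
proof -
  interpret G: comm_group G using assms(1) by (rule complex_structureD)
  interpret H: comm_group H
    using G.iso_imp_comm_group assms(2) group.is_monoid[OF assms(3)] by blast
  obtain h where h: "h \<in> iso G H" using assms(2) by (auto simp: is_iso_def)
  then obtain k where k: "group_isomorphisms G H h k" using G.iso_iff_group_isomorphisms by blast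
  then have hk: "h \<in> hom G H" "k \<in> hom H G" "\<And>x. x \<in> carrier G \<Longrightarrow> k (h x) = x" "\<And>y. y \<in> carrier H \<Longrightarrow> h (k y) = y"
    by (auto simp: group_isomorphisms_def)
  interpret h: group_hom G H h
    using hk(1) by unfold_locales
  have "h \<circ> f \<circ> k \<in> hom H H"
    using hk(1,2) complex_structureD(3)[OF assms(1)] by (intro hom_compose)
  moreover have "(h \<circ> f \<circ> k) ((h \<circ> f \<circ> k) y) = inv\<^bsub>H\<^esub> y" if "y \<in> carrier H" for y
    using that hk complex_structureD(4,5)[OF assms(1)] hom_in_carrier[OF hk(2) that] h.hom_inv[of "k y"]
    by simp
  ultimately show ?thesis
    using H.comm_group_axioms by (auto simp: complex_structure_def)
qed

lemma comm_group_product_group: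
  assumes "\<And>i. i \<in> I \<Longrightarrow> comm_group (G i)"
  shows "comm_group (product_group I G)"
proof -
  have grp: "group (G i)" if "i \<in> I" for i using assms[OF that] by (simp add: comm_group_def)
  then interpret group "product_group I G" by (rule product_group)
  show ?thesis
    using assms by (intro group_comm_groupI) (auto simp: comm_groupE(4) PiE_iff intro!: restrict_ext)
qed

lemma complex_structure_product_group:
  assumes "\<And>i. i \<in> I \<Longrightarrow> \<exists>f. complex_structure (G i) f"
  shows "\<exists>f. complex_structure (product_group I G) f"
proof -
  obtain f where f: "\<And>i. i \<in> I \<Longrightarrow> complex_structure (G i) (f i)" using assms by metis
  note f' = complex_structureD[OF f]
  have "comm_group (product_group I G)"
    using f' by (intro comm_group_product_group)
  moreover have "(\<lambda>x. \<lambda>i\<in>I. f i (x i)) \<in> hom (product_group I G) (product_group I G)"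
    using f' by (intro homI) (auto simp: PiE_iff fun_eq_iff hom_mult[OF f'(3)])
  moreover have "(\<lambda>i\<in>I. f i ((\<lambda>i\<in>I. f i (x i)) i)) = inv\<^bsub>product_group I G\<^esub> x"
    if "x \<in> carrier (product_group I G)" for x
    using that f' by (subst inv_product_group) (auto simp: PiE_iff fun_eq_iff)
  ultimately show ?thesis
    unfolding complex_structure_def by blast
qed

subsection \<open>Cyclic modules over the Gaussian integers\<close>

text \<open>Up to isomorphism this is the module Z[i]/(c), with \<open>y\<close> as the class of 1
  and \<open>f\<close> as multiplication by i; it is free for \<open>c = 0\<close>. A generator with
  its annihilator fits subgroups directly, and \<open>c\<close> counts only up to units.\<close>

definition gauss_cyclic :: "('a, 'b) monoid_scheme \<Rightarrow> ('a \<Rightarrow> 'a) \<Rightarrow> 'a \<Rightarrow> gauss_int \<Rightarrow> bool"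
  where "gauss_cyclic C f y c \<longleftrightarrow> complex_structure C f \<and> y \<in> carrier C \<and>
    (\<forall>x\<in>carrier C. \<exists>r. x = gact C f r y) \<and> (\<forall>r. gact C f r y = \<one>\<^bsub>C\<^esub> \<longleftrightarrow> c dvd r)"

text \<open>The homomorphism from pairs of integers given by \<open>y\<close> and \<open>w\<close>
  is onto with kernel aZ + bZ taken coordinatewise, so it factors through the residues. With
  \<open>a = 0\<close> or \<open>b = 0\<close> the factor is Z.\<close>

lemma (in comm_group) has_cyclic_type_two_generators:
  assumes y: "y \<in> carrier G" and w: "w \<in> carrier G"
    and gen: "\<And>x. x \<in> carrier G \<Longrightarrow> \<exists>m n. x = y [^] (m::int) \<otimes> w [^] (n::int)"
    and rel: "\<And>m n. y [^] (m::int) \<otimes> w [^] (n::int) = \<one> \<longleftrightarrow> int a dvd m \<and> int b dvd n"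
  shows "has_cyclic_type G {#a, b#}"
proof -
  define h where "h = (\<lambda>(m::int, n::int). y [^] m \<otimes> w [^] n)"
  have h_eq: "h (m, n) = h (m', n') \<longleftrightarrow> int a dvd m - m' \<and> int b dvd n - n'" for m n m' n'
  proof -
    have "h (m, n) \<otimes> inv (h (m', n')) = y [^] (m - m') \<otimes> w [^] (n - n')"
      using y w by (simp add: h_def int_pow_diff inv_mult m_ac)
    moreover have "h (m, n) = h (m', n') \<longleftrightarrow> h (m, n) \<otimes> inv (h (m', n')) = \<one>"
      using y w by (metis (no_types, lifting) h_def case_prod_conv int_pow_closed inv_closed inv_equality
          inv_inv m_closed r_inv)
    ultimately show ?thesis using rel by simp
  qed
  have h_mod: "h (m mod int a, n mod int b) = h (m, n)" for m n
    by (simp add: h_eq mod_eq_dvd_iff[symmetric])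
  have "h \<in> iso (integer_mod_group a \<times>\<times> integer_mod_group b) G"
  proof (rule isoI)
    show "h \<in> hom (integer_mod_group a \<times>\<times> integer_mod_group b) G"
    proof (rule homI)
      fix u v :: "int \<times> int"
      have "h (fst u + fst v, snd u + snd v) = h u \<otimes> h v"
        using y w by (simp add: h_def int_pow_mult m_ac split: prod.split)
      then show "h (u \<otimes>\<^bsub>integer_mod_group a \<times>\<times> integer_mod_group b\<^esub> v) = h u \<otimes> h v"
        by (simp add: mult_DirProd' h_mod)
    qed (use y w in \<open>auto simp: h_def\<close>)
    have "inj_on h (carrier (integer_mod_group a \<times>\<times> integer_mod_group b))"
      by (auto simp: inj_on_def h_eq carrier_integer_mod_group mod_eq_dvd_iff[symmetric] split: if_splits)
    moreover have "x \<in> h ` carrier (integer_mod_group a \<times>\<times> integer_mod_group b)" if "x \<in> carrier G" for x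
    proof -
      obtain m n where "x = h (m, n)" using gen[OF \<open>x \<in> carrier G\<close>] by (auto simp: h_def)
      then show ?thesis
        by (intro image_eqI[of _ _ "(m mod int a, n mod int b)"])
          (auto simp: h_mod carrier_integer_mod_group)
    qed
    ultimately show "bij_betw h (carrier (integer_mod_group a \<times>\<times> integer_mod_group b)) (carrier G)"
      using y w by (auto simp: bij_betw_def h_def)
  qed
  moreover have "has_cyclic_type (integer_mod_group a \<times>\<times> integer_mod_group b) ({#a#} + {#b#})"
    by (intro has_cyclic_type_DirProd has_cyclic_type_integer_mod_group)
  ultimately show ?thesis
    by (metis add_mset_add_single has_cyclic_type_iso is_group is_isoI add_mset_commute)
qed

lemma gauss_cyclic_cong: "\<lbrakk>gauss_cyclic C f y c; \<And>r. c dvd r \<longleftrightarrow> d dvd r\<rbrakk> \<Longrightarrow> gauss_cyclic C f y d"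
  by (simp add: gauss_cyclic_def)

text \<open>The ideal (n) is diagonal in the basis 1, i, so \<open>y\<close> and \<open>f y\<close>
  are independent generators. The case \<open>n = 0\<close> gives two copies of Z.\<close>

lemma has_cyclic_type_gauss_cyclic_int:
  assumes "gauss_cyclic C f y (Gauss (int n) 0)"
  shows "has_cyclic_type C {#n, n#}"
proof -
  have cs: "complex_structure C f" and y: "y \<in> carrier C"
    and gen: "\<And>x. x \<in> carrier C \<Longrightarrow> \<exists>r. x = gact C f r y"
    and rel: "\<And>r. gact C f r y = \<one>\<^bsub>C\<^esub> \<longleftrightarrow> Gauss (int n) 0 dvd r"
    using assms by (auto simp: gauss_cyclic_def)
  have gact: "y [^]\<^bsub>C\<^esub> (k::int) \<otimes>\<^bsub>C\<^esub> f y [^]\<^bsub>C\<^esub> (l::int) = gact C f (Gauss k l) y" for k l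
    by (simp add: gact_def)
  show ?thesis
  proof (rule comm_group.has_cyclic_type_two_generators[OF complex_structureD(1)[OF cs] y])
    show "f y \<in> carrier C" using cs y by (rule complex_structureD)
  next
    fix x assume "x \<in> carrier C"
    then show "\<exists>k l. x = y [^]\<^bsub>C\<^esub> (k::int) \<otimes>\<^bsub>C\<^esub> f y [^]\<^bsub>C\<^esub> (l::int)"
      using gen unfolding gact by (metis gauss_int.exhaust)
  next
    show "y [^]\<^bsub>C\<^esub> k \<otimes>\<^bsub>C\<^esub> f y [^]\<^bsub>C\<^esub> l = \<one>\<^bsub>C\<^esub> \<longleftrightarrow> int n dvd k \<and> int n dvd l" for k l
      unfolding gact rel by (simp add: Gauss_dvd_iff)
  qed
qed

text \<open>The generators are \<open>y\<close> and 1 + i times \<open>y\<close>, because it is in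
  this basis that \<open>one_plus_i_power_dvd_iff\<close> describes the annihilator by separate
  conditions.\<close>

lemma has_cyclic_type_gauss_cyclic_one_plus_i:
  assumes "gauss_cyclic C f y (Gauss 1 1 ^ n)"
  shows "has_cyclic_type C {#2 ^ (Suc n div 2), 2 ^ (n div 2)#}"
proof -
  have cs: "complex_structure C f" and y: "y \<in> carrier C"
    and gen: "\<And>x. x \<in> carrier C \<Longrightarrow> \<exists>r. x = gact C f r y"
    and rel: "\<And>r. gact C f r y = \<one>\<^bsub>C\<^esub> \<longleftrightarrow> Gauss 1 1 ^ n dvd r"
    using assms by (auto simp: gauss_cyclic_def)
  interpret euclidean_action C "gact C f" "\<lambda>z. nat (gnorm z)"
    using cs by (rule euclidean_action_gact)
  have int: "gact C f (Gauss k 0) x = x [^]\<^bsub>C\<^esub> k" if "x \<in> carrier C" for x k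
    using that complex_structureD(4)[OF cs that] by (simp add: gact_def)
  define w where "w = gact C f (Gauss 1 1) y"
  have w: "w \<in> carrier C" using y by (simp add: w_def)
  have gact: "y [^]\<^bsub>C\<^esub> k \<otimes>\<^bsub>C\<^esub> w [^]\<^bsub>C\<^esub> l = gact C f (Gauss k 0 + Gauss 1 1 * Gauss l 0) y" for k l
    using y w smult_mult[of y "Gauss l 0" "Gauss 1 1"] by (simp add: smult_add int w_def mult.commute)
  show ?thesis
  proof (rule comm_group.has_cyclic_type_two_generators[OF complex_structureD(1)[OF cs] y w])
    fix x assume "x \<in> carrier C"
    then obtain r where "x = gact C f r y" using gen by blast
    also have "r = Gauss (gre r - gim r) 0 + Gauss 1 1 * Gauss (gim r) 0"
      by (cases r) (simp add: gauss_int_defs)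
    finally show "\<exists>k l. x = y [^]\<^bsub>C\<^esub> (k::int) \<otimes>\<^bsub>C\<^esub> w [^]\<^bsub>C\<^esub> (l::int)"
      unfolding gact by blast
  next
    show "y [^]\<^bsub>C\<^esub> k \<otimes>\<^bsub>C\<^esub> w [^]\<^bsub>C\<^esub> l = \<one>\<^bsub>C\<^esub> \<longleftrightarrow>
        int (2 ^ (Suc n div 2)) dvd k \<and> int (2 ^ (n div 2)) dvd l" for k l
      unfolding gact rel one_plus_i_power_dvd_iff by simp
  qed
qed

text \<open>The norm of \<open>c\<close> is a multiple of \<open>c\<close> and so annihilates
  \<open>y\<close>; coefficients may be reduced modulo it in both coordinates.\<close>

lemma finite_gauss_cyclic:
  assumes "gauss_cyclic C f y c" "c \<noteq> 0"
  shows "finite (carrier C)"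
proof -
  have cs: "complex_structure C f" and y: "y \<in> carrier C"
    and gen: "\<And>x. x \<in> carrier C \<Longrightarrow> \<exists>r. x = gact C f r y"
    and rel: "\<And>r. gact C f r y = \<one>\<^bsub>C\<^esub> \<longleftrightarrow> c dvd r"
    using assms by (auto simp: gauss_cyclic_def)
  interpret euclidean_action C "gact C f" "\<lambda>z. nat (gnorm z)"
    using cs by (rule euclidean_action_gact)
  define n where "n = gnorm c"
  have n: "n > 0" using assms(2) gnorm_eq_0_iff[of c] gnorm_nonneg[of c] by (auto simp: n_def)
  have "x \<in> (\<lambda>(a, b). gact C f (Gauss a b) y) ` ({0..<n} \<times> {0..<n})" if x: "x \<in> carrier C" for x
  proof -
    obtain r where r: "x = gact C f r y" using gen[OF x] by blast
    let ?s = "Gauss (gre r mod n) (gim r mod n)"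
    have "r - ?s = Gauss n 0 * Gauss (gre r div n) (gim r div n)"
      by (simp add: gauss_int_defs minus_mod_eq_mult_div)
    also have "\<dots> = c * (gcnj c * Gauss (gre r div n) (gim r div n))"
      by (simp add: mult_gcnj n_def flip: mult.assoc)
    finally have "gact C f (r - ?s) y = \<one>\<^bsub>C\<^esub>" using rel by simp
    then have "x = gact C f ?s y"
      using smult_add[OF y, of "r - ?s" ?s] y r by simp
    then show ?thesis using n by force
  qed
  then show ?thesis by (rule finite_subset[OF subsetI]) auto
qed

section \<open>Splitting a finitely generated Z[i]-module into cyclic modules\<close>

lemma (in comm_group) product_group_iso_internal:
  assumes "finite I" "\<And>i. i \<in> I \<Longrightarrow> subgroup (D i) G"
    and gen: "\<And>x. x \<in> carrier G \<Longrightarrow> \<exists>u. (\<forall>i\<in>I. u i \<in> D i) \<and> x = finprod G u I"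
    and rel: "\<And>u. \<lbrakk>\<forall>i\<in>I. u i \<in> D i; finprod G u I = \<one>\<rbrakk> \<Longrightarrow> \<forall>i\<in>I. u i = \<one>"
  shows "product_group I (\<lambda>i. G\<lparr>carrier := D i\<rparr>) \<cong> G"
proof (rule is_isoI[of "\<lambda>u. finprod G u I"], rule isoI)
  let ?P = "product_group I (\<lambda>i. G\<lparr>carrier := D i\<rparr>)"
  have D: "x \<in> carrier G" if "x \<in> D i" "i \<in> I" for i x
    using subgroup.mem_carrier[OF assms(2)[OF that(2)] that(1)] .
  show hom: "(\<lambda>u. finprod G u I) \<in> hom ?P G"
  proof (rule homI)
    fix u v assume "u \<in> carrier ?P" "v \<in> carrier ?P"
    then have uv: "u \<in> I \<rightarrow> carrier G" "v \<in> I \<rightarrow> carrier G"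
      using D by (auto simp: PiE_iff)
    have "finprod G (u \<otimes>\<^bsub>?P\<^esub> v) I = finprod G (\<lambda>i. u i \<otimes> v i) I"
      using uv by (intro finprod_cong') auto
    also have "\<dots> = finprod G u I \<otimes> finprod G v I"
      using uv by (intro finprod_multf)
    finally show "finprod G (u \<otimes>\<^bsub>?P\<^esub> v) I = finprod G u I \<otimes> finprod G v I" .
  qed (use D in \<open>auto simp: PiE_iff intro!: finprod_closed\<close>)
  have "group ?P"
    using assms(2) by (intro product_group subgroup.subgroup_is_group is_group)
  then interpret h: group_hom ?P G "\<lambda>u. finprod G u I"
    using hom by (simp add: group_hom_def group_hom_axioms_def is_group)
  have "inj_on (\<lambda>u. finprod G u I) (carrier ?P)"
    unfolding h.inj_on_one_iff using rel by (auto simp: PiE_iff fun_eq_iff extensional_def)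
  moreover have "x \<in> (\<lambda>u. finprod G u I) ` carrier ?P" if "x \<in> carrier G" for x
  proof -
    obtain u where u: "\<forall>i\<in>I. u i \<in> D i" "x = finprod G u I" using gen[OF \<open>x \<in> carrier G\<close>] by blast
    moreover have "finprod G u I = finprod G (restrict u I) I"
      using u D by (intro finprod_cong') auto
    ultimately show ?thesis by (intro image_eqI[of _ _ "restrict u I"]) auto
  qed
  ultimately show "bij_betw (\<lambda>u. finprod G u I) (carrier ?P) (carrier G)"
    by (auto simp: bij_betw_def)
qed

lemma gact_consistent:
  assumes "group G" "subgroup H G" "x \<in> H" "f x \<in> H"
  shows "gact (G\<lparr>carrier := H\<rparr>) f r x = gact G f r x"
  using assms by (simp add: gact_def flip: group.int_pow_consistent)

lemma gact_int:
  assumes "complex_structure G f" "x \<in> carrier G"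
  shows "gact G f (Gauss k 0) x = x [^]\<^bsub>G\<^esub> k"
proof -
  interpret comm_group G using assms(1) by (rule complex_structureD)
  show ?thesis using assms(2) complex_structureD(4)[OF assms] by (simp add: gact_def)
qed

lemma gact_i:
  assumes "complex_structure G f" "x \<in> carrier G"
  shows "gact G f (Gauss 0 1) x = f x"
proof -
  interpret comm_group G using assms(1) by (rule complex_structureD)
  show ?thesis using assms(2) complex_structureD(4)[OF assms] by (simp add: gact_def)
qed

text \<open>A finite generating set, indexed by itself, is the family handed to
  \<open>exists_basis\<close>. That every relation has its coefficients divisible by the
  annihilators says exactly that the sum of the cyclic submodules is direct.\<close>

lemma gauss_decomposition:
  fixes G :: "('a, 'b) monoid_scheme" (structure)
  assumes cs: "complex_structure G f" and fg: "finitely_generated_group G"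
  shows "\<exists>I D y c. finite (I :: 'a set) \<and>
    (\<forall>i\<in>I. subgroup (D i) G \<and> gauss_cyclic (G\<lparr>carrier := D i\<rparr>) f (y i) (c i)) \<and>
    product_group I (\<lambda>i. G\<lparr>carrier := D i\<rparr>) \<cong> G"
proof -
  interpret euclidean_action G "gact G f" "\<lambda>z. nat (gnorm z)"
    using cs by (rule euclidean_action_gact)
  obtain I where I: "finite I" "I \<subseteq> carrier G" "generate G I = carrier G"
    using fg by (auto simp: finitely_generated_group_def)
  have id: "id \<in> I \<rightarrow> carrier G" using I(2) by auto
  have "I \<subseteq> span I id" using span_superset[OF I(1) id] by auto
  then have "generate G I \<subseteq> span I id"
    using subgroup_span[OF I(1) id] by (rule generate_subgroup_incl)
  with I(3) have span: "span I id = carrier G"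
    using id by (auto simp: span_def)
  obtain y c where y: "y \<in> I \<rightarrow> carrier G" "span I y = carrier G" and kill: "\<And>j. j \<in> I \<Longrightarrow> gact G f (c j) (y j) = \<one>"
    and rel: "\<And>r j. \<lbrakk>lin I r y = \<one>; j \<in> I\<rbrakk> \<Longrightarrow> c j dvd r j"
    using exists_basis[OF I(1) id] unfolding span by blast
  define D where "D = (\<lambda>i. range (\<lambda>r. gact G f r (y i)))"
  have yc: "y i \<in> carrier G" if "i \<in> I" for i using funcset_mem[OF y(1) that] .
  have D: "subgroup (D i) G" if "i \<in> I" for i
    unfolding D_def using yc[OF that] by (rule subgroup_cyclic)
  have yD: "y i \<in> D i" if "i \<in> I" for i
    unfolding D_def using smult_one[OF yc[OF that]] by (metis rangeI)
  have fD: "f x \<in> D i" if x: "x \<in> D i" and i: "i \<in> I" for x i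
  proof -
    obtain r where r: "x = gact G f r (y i)" using x by (auto simp: D_def)
    then have "f x = gact G f (Gauss 0 1 * r) (y i)"
      using yc[OF i] by (simp add: smult_mult gact_i[OF cs])
    then show ?thesis by (auto simp: D_def)
  qed
  have zero_iff: "gact G f r (y i) = \<one> \<longleftrightarrow> c i dvd r" if "i \<in> I" for r i
  proof
    assume "c i dvd r"
    then obtain s where "r = s * c i" by (metis dvdE mult.commute)
    then show "gact G f r (y i) = \<one>" using kill[OF that] yc[OF that] by (simp add: smult_mult)
  next
    assume *: "gact G f r (y i) = \<one>"
    \<comment> \<open>Padded with zeros, a relation of one generator becomes a relation of the
      family.\<close>
    let ?r = "\<lambda>j. if j = i then r else 0"
    have "lin I ?r y = \<one>"
      using * yc by (intro lin_zero y) auto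
    from rel[OF this that] show "c i dvd r" by simp
  qed
  have cyc: "gauss_cyclic (G\<lparr>carrier := D i\<rparr>) f (y i) (c i)" if "i \<in> I" for i
  proof -
    have "gact (G\<lparr>carrier := D i\<rparr>) f r (y i) = gact G f r (y i)" for r
      using yD[OF that] fD[OF yD[OF that] that] by (intro gact_consistent[OF is_group D[OF that]])
    moreover have "complex_structure (G\<lparr>carrier := D i\<rparr>) f"
      using complex_structure_subgroup[OF cs D[OF that]] fD that by blast
    ultimately show ?thesis
      using yD[OF that] zero_iff[OF that] by (auto simp: gauss_cyclic_def D_def)
  qed
  have "product_group I (\<lambda>i. G\<lparr>carrier := D i\<rparr>) \<cong> G"
  proof (rule product_group_iso_internal[OF I(1) D])
    fix x assume "x \<in> carrier G"
    then obtain r where "x = lin I r y" using y(2) by (auto simp: span_def)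
    then show "\<exists>u. (\<forall>i\<in>I. u i \<in> D i) \<and> x = finprod G u I"
      by (intro exI[of _ "\<lambda>j. gact G f (r j) (y j)"]) (auto simp: lin_def D_def)
  next
    fix u assume u: "\<forall>i\<in>I. u i \<in> D i" "finprod G u I = \<one>"
    then have "\<forall>i\<in>I. \<exists>r. u i = gact G f r (y i)" by (auto simp: D_def)
    from bchoice[OF this] obtain r where r: "\<And>i. i \<in> I \<Longrightarrow> u i = gact G f (r i) (y i)" by blast
    \<comment> \<open>The trivial product is a relation between the \<open>y i\<close>; hence
      \<open>c i\<close> divides each \<open>r i\<close>, and every factor is already
      trivial.\<close>
    have "lin I r y = finprod G u I"
      unfolding lin_def by (rule finprod_cong') (auto simp: r yc)
    then have "c i dvd r i" if "i \<in> I" for i using rel[of r, OF _ that] u(2) by simp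
    then show "\<forall>i\<in>I. u i = \<one>" using r zero_iff by auto
  qed
  then show ?thesis using I(1) D cyc by blast
qed

lemma finitely_generated_finite: "\<lbrakk>group G; finite (carrier G)\<rbrakk> \<Longrightarrow> finitely_generated_group G"
  unfolding finitely_generated_group_def
  using group.generate_incl[of G "carrier G"] generate.incl[of _ "carrier G" G] by blast

text \<open>The theorem asks for \<open>T\<close> and \<open>E\<close> of type
  \<open>nat monoid\<close>, whereas the constructions live on functions into other types.\<close>

lemma finite_group_iso_nat:
  assumes "group G" "finite (carrier G)"
  shows "\<exists>H :: nat monoid. group H \<and> G \<cong> H"
proof -
  obtain h :: "'a \<Rightarrow> nat" where "inj_on h (carrier G)"
    using finite_imp_inj_to_nat_seg[OF assms(2)] by blast
  then show ?thesis
    using group.inj_imp_image_group_is_group[OF assms(1)] inj_imp_image_group_iso is_isoI by blast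
qed

lemma finite_product_group_carrier:
  assumes "finite I" "\<And>i. i \<in> I \<Longrightarrow> finite (carrier (G i))"
  shows "finite (carrier (product_group I G))"
  using assms by (simp add: finite_PiE)

text \<open>Summands with \<open>c = 0\<close> contribute Z twice, so the rank is even; the others
  are finite and stable under \<open>f\<close>, so \<open>T\<close> inherits a complex structure for
  the study of its primary components. The case \<open>m = 0\<close> still occurs here.\<close>

theorem complex_structure_free_finite_decomposition:
  fixes A :: "('a, 'b) monoid_scheme"
  assumes cs: "complex_structure A f" and fg: "finitely_generated_group A"
  shows "\<exists>m (T :: nat monoid) g. A \<cong> direct_power integer_group (2 * m) \<times>\<times> T \<and>
    finite (carrier T) \<and> complex_structure T g"
proof -
  obtain I :: "'a set" and D y c where I: "finite I"
    and cyc: "\<And>i. i \<in> I \<Longrightarrow> gauss_cyclic (A\<lparr>carrier := D i\<rparr>) f (y i) (c i)"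
    and iso: "product_group I (\<lambda>i. A\<lparr>carrier := D i\<rparr>) \<cong> A"
    using gauss_decomposition[OF cs fg] by blast
  let ?C = "\<lambda>i. A\<lparr>carrier := D i\<rparr>"
  have csC: "complex_structure (?C i) f" if "i \<in> I" for i
    using cyc[OF that] by (simp add: gauss_cyclic_def)
  have grp: "group (?C i)" if "i \<in> I" for i
    using csC[OF that] by (rule complex_structureD)
  define F where "F = {i \<in> I. c i = 0}"
  define R where "R = {i \<in> I. c i \<noteq> 0}"
  have FR: "F \<union> R = I" "F \<inter> R = {}" "F \<subseteq> I" "R \<subseteq> I" "finite F" "finite R"
    using I by (auto simp: F_def R_def)
  have "has_cyclic_type (product_group F ?C) (\<Sum>i\<in>F. {#0, 0#})"
  proof (rule has_cyclic_type_product_group[OF \<open>finite F\<close>])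
    fix i assume "i \<in> F"
    then show "has_cyclic_type (?C i) {#0, 0#}"
      using cyc[of i] by (intro has_cyclic_type_gauss_cyclic_int[of _ f "y i"]) (simp add: F_def zero_gauss_int_def)
  qed
  also have "(\<Sum>i\<in>F. {#0, 0#}) = repeat_mset (2 * card F) {#0::nat#}"
    by (simp add: multiset_eq_iff count_sum)
  finally have "has_cyclic_type (product_group F ?C) \<dots>" .
  moreover have "has_cyclic_type integer_group {#0#}"
    using has_cyclic_type_integer_mod_group[of 0] by (simp add: integer_mod_group_def)
  then have "has_cyclic_type (direct_power integer_group (2 * card F)) (repeat_mset (2 * card F) {#0#})"
    by (rule has_cyclic_type_direct_power)
  ultimately have free: "product_group F ?C \<cong> direct_power integer_group (2 * card F)"
    by (rule has_cyclic_type_unique)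
  have "finite (carrier (product_group R ?C))"
    using FR finite_gauss_cyclic[OF cyc] by (intro finite_product_group_carrier) (auto simp: R_def)
  moreover have "group (product_group R ?C)" "group (product_group F ?C)"
    using FR grp by (auto intro!: product_group)
  ultimately obtain T :: "nat monoid" where T: "group T" "product_group R ?C \<cong> T"
    using finite_group_iso_nat by blast
  have "\<exists>g. complex_structure (product_group R ?C) g"
    using csC FR by (intro complex_structure_product_group) blast
  then obtain g where g: "complex_structure T g"
    using complex_structure_iso T by blast
  have "A \<cong> product_group I ?C"
    using product_group[OF grp] iso by (rule group.iso_sym)
  also have "\<dots> \<cong> product_group F ?C \<times>\<times> product_group R ?C"
    using product_group_Un_iso[OF FR(2), of ?C] FR(1) by simp
  also have "\<dots> \<cong> direct_power integer_group (2 * card F) \<times>\<times> T"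
    by (rule group.DirProd_iso_trans[OF \<open>group (product_group F ?C)\<close> free T(2)])
  finally show ?thesis
    using g iso_finite[OF T(2)] \<open>finite (carrier (product_group R ?C))\<close>
    by (intro exI[of _ "card F"] exI[of _ T] exI[of _ g]) simp
qed

subsection \<open>Primary components\<close>

lemma (in comm_group) subgroup_primary_component:
  fixes p :: nat
  shows "subgroup {x \<in> carrier G. \<exists>k::nat. x [^] (p ^ k) = \<one>} G"
proof (rule subgroupI)
  fix a b assume "a \<in> {x \<in> carrier G. \<exists>k::nat. x [^] (p ^ k) = \<one>}" "b \<in> {x \<in> carrier G. \<exists>k::nat. x [^] (p ^ k) = \<one>}"
  then obtain k l :: nat where a: "a \<in> carrier G" "a [^] (p ^ k) = \<one>" and b: "b \<in> carrier G" "b [^] (p ^ l) = \<one>" by blast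
  then have "a [^] (p ^ k * p ^ l) = \<one>" "b [^] (p ^ l * p ^ k) = \<one>"
    by (simp_all add: a b nat_pow_pow[OF a(1), symmetric] nat_pow_pow[OF b(1), symmetric])
  then have "(a \<otimes> b) [^] (p ^ (k + l)) = \<one>"
    using a b by (simp add: nat_pow_distrib power_add mult.commute)
  then show "a \<otimes> b \<in> {x \<in> carrier G. \<exists>k::nat. x [^] (p ^ k) = \<one>}"
    using a b by blast
  have "inv a [^] (p ^ k) = \<one>" using a by (simp add: nat_pow_inv)
  then show "inv a \<in> {x \<in> carrier G. \<exists>k::nat. x [^] (p ^ k) = \<one>}"
    using a by blast
qed (auto intro: exI[of _ "\<one>"])

lemma primary_component_pow:
  assumes "x \<in> carrier (primary_component p T)"
  shows "\<exists>k. x [^]\<^bsub>primary_component p T\<^esub> (p ^ k) = \<one>\<^bsub>primary_component p T\<^esub>"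
  using assms by (auto simp: primary_component_def nat_pow_def)

lemma complex_structure_primary_component:
  assumes "complex_structure T f"
  shows "complex_structure (primary_component p T) f"
proof -
  interpret comm_group T using assms by (rule complex_structureD)
  show ?thesis
    unfolding primary_component_def
  proof (rule complex_structure_subgroup[OF assms subgroup_primary_component])
    fix x assume "x \<in> {x \<in> carrier T. \<exists>k::nat. x [^]\<^bsub>T\<^esub> (p ^ k) = \<one>\<^bsub>T\<^esub>}"
    then obtain k :: nat where x: "x \<in> carrier T" "x [^]\<^bsub>T\<^esub> (p ^ k) = \<one>\<^bsub>T\<^esub>" by blast
    have "f x [^]\<^bsub>T\<^esub> (p ^ k) = f (x [^]\<^bsub>T\<^esub> (p ^ k))"
      using hom_nat_pow[OF complex_structureD(3)[OF assms] x(1) is_group is_group] by simp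
    also have "\<dots> = \<one>\<^bsub>T\<^esub>"
      using x hom_one[OF complex_structureD(3)[OF assms] is_group is_group] by simp
    finally show "f x \<in> {x \<in> carrier T. \<exists>k::nat. x [^]\<^bsub>T\<^esub> (p ^ k) = \<one>\<^bsub>T\<^esub>}"
      using x complex_structureD(4)[OF assms] by blast
  qed
qed

text \<open>Here \<open>q\<close> is an inert prime or 1 + i. As a power of \<open>q\<close> kills
  each generator, its annihilator is \<open>q ^ n\<close> up to a unit, and \<open>t n\<close> is
  the type of Z[i] modulo \<open>q ^ n\<close>.\<close>

lemma primary_type:
  fixes G :: "('a, 'b) monoid_scheme"
  assumes cs: "complex_structure G f" and fin: "finite (carrier G)" and q: "prime_elem q"
    and tors: "\<And>x. x \<in> carrier G \<Longrightarrow> \<exists>k. gact G f (q ^ k) x = \<one>\<^bsub>G\<^esub>"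
    and type: "\<And>(C :: ('a, 'b) monoid_scheme) y n. gauss_cyclic C f y (q ^ n) \<Longrightarrow> has_cyclic_type C (t n)"
  shows "\<exists>(I :: 'a set) n. finite I \<and> has_cyclic_type G (\<Sum>i\<in>I. t (n i))"
proof -
  interpret group G using cs by (rule complex_structureD)
  obtain I :: "'a set" and D y c where I: "finite I" and D: "\<And>i. i \<in> I \<Longrightarrow> subgroup (D i) G"
    and cyc: "\<And>i. i \<in> I \<Longrightarrow> gauss_cyclic (G\<lparr>carrier := D i\<rparr>) f (y i) (c i)"
    and iso: "product_group I (\<lambda>i. G\<lparr>carrier := D i\<rparr>) \<cong> G"
    using gauss_decomposition[OF cs finitely_generated_finite[OF is_group fin]] by blast
  have "\<forall>i\<in>I. \<exists>n. has_cyclic_type (G\<lparr>carrier := D i\<rparr>) (t n)"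
  proof
    fix i assume i: "i \<in> I"
    have y: "y i \<in> D i" "f (y i) \<in> D i"
      using cyc[OF i] complex_structureD(4)[of "G\<lparr>carrier := D i\<rparr>" f] by (auto simp: gauss_cyclic_def)
    then have "y i \<in> carrier G" using subgroup.mem_carrier[OF D[OF i]] by blast
    then obtain k where "gact G f (q ^ k) (y i) = \<one>\<^bsub>G\<^esub>" using tors by blast
    then have "c i dvd q ^ k"
      using cyc[OF i] gact_consistent[OF is_group D[OF i], of "y i" f] y by (simp add: gauss_cyclic_def)
    then obtain n u where n: "c i = q ^ n * u" "u dvd 1"
      by (rule dvd_prime_elem_power_cases[OF q])
    have "c i dvd r \<longleftrightarrow> q ^ n dvd r" for r
    proof
      assume "q ^ n dvd r"
      then have "q ^ n * u dvd r * 1" using n(2) by (metis mult_dvd_mono dvd_trans dvd_refl)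
      then show "c i dvd r" using n(1) by simp
    qed (use n(1) in \<open>auto dest: dvd_mult_left\<close>)
    then have "gauss_cyclic (G\<lparr>carrier := D i\<rparr>) f (y i) (q ^ n)"
      by (rule gauss_cyclic_cong[OF cyc[OF i]])
    then show "\<exists>n. has_cyclic_type (G\<lparr>carrier := D i\<rparr>) (t n)" using type by blast
  qed
  from bchoice[OF this] obtain n where "\<And>i. i \<in> I \<Longrightarrow> has_cyclic_type (G\<lparr>carrier := D i\<rparr>) (t (n i))" by blast
  then have "has_cyclic_type (product_group I (\<lambda>i. G\<lparr>carrier := D i\<rparr>)) (\<Sum>i\<in>I. t (n i))"
    by (rule has_cyclic_type_product_group[OF I])
  then have "has_cyclic_type G (\<Sum>i\<in>I. t (n i))"
    using iso is_group by (rule has_cyclic_type_iso)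
  then show ?thesis using I by blast
qed

lemma primary_type_inert:
  fixes G :: "('a, 'b) monoid_scheme"
  assumes cs: "complex_structure G f" and fin: "finite (carrier G)"
    and p: "Factorial_Ring.prime p" "[p = 3] (mod 4)"
    and tors: "\<And>x. x \<in> carrier G \<Longrightarrow> \<exists>k::nat. x [^]\<^bsub>G\<^esub> (p ^ k) = \<one>\<^bsub>G\<^esub>"
  shows "\<exists>mp :: nat \<Rightarrow> nat. finite {k. 1 \<le> k \<and> mp k \<noteq> 0} \<and>
    G \<cong> sum_group {1..} (\<lambda>k. direct_power (integer_mod_group (p ^ k)) (2 * mp k))"
proof -
  \<comment> \<open>The zero module must give the empty type, because exponent 0 lies outside the
    index range \<open>{1..}\<close>.\<close>
  define t where "t = (\<lambda>n. if n = 0 then {#} else {#p ^ n, p ^ n#})"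
  have "\<exists>(I :: 'a set) n. finite I \<and> has_cyclic_type G (\<Sum>i\<in>I. t (n i))"
  proof (rule primary_type[OF cs fin prime_elem_Gauss[OF p]])
    fix x assume x: "x \<in> carrier G"
    then obtain k where "x [^]\<^bsub>G\<^esub> (p ^ k) = \<one>\<^bsub>G\<^esub>" using tors by blast
    then have "gact G f (Gauss (int p) 0 ^ k) x = \<one>\<^bsub>G\<^esub>"
      using gact_int[OF cs x, of "int (p ^ k)"] by (simp add: Gauss_power flip: int_pow_int)
    then show "\<exists>k. gact G f (Gauss (int p) 0 ^ k) x = \<one>\<^bsub>G\<^esub>" ..
  next
    fix C :: "('a, 'b) monoid_scheme" and y n
    assume "gauss_cyclic C f y (Gauss (int p) 0 ^ n)"
    then have "has_cyclic_type C {#p ^ n, p ^ n#}"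
      by (intro has_cyclic_type_gauss_cyclic_int) (simp add: Gauss_power)
    from has_cyclic_type_filter[OF this] show "has_cyclic_type C (t n)"
      using prime_gt_1_nat[OF p(1)] by (simp add: t_def split: if_splits)
  qed
  then obtain I :: "'a set" and n where I: "finite I" and G: "has_cyclic_type G (\<Sum>i\<in>I. t (n i))" by blast
  define mp where "mp = (\<lambda>k. card {i \<in> I. n i = k})"
  let ?J = "n ` I - {0}"
  let ?C = "\<lambda>k. direct_power (integer_mod_group (p ^ k)) (2 * mp k)"
  have mp0: "mp k = 0" if "k \<notin> n ` I" for k
    using that by (auto simp: mp_def card_eq_0_iff)
  have "(\<Sum>i\<in>I. t (n i)) = (\<Sum>k\<in>n ` I. \<Sum>i\<in>{i \<in> I. n i = k}. t (n i))"
    using I by (rule sum.image_gen)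
  also have "\<dots> = (\<Sum>k\<in>n ` I. repeat_mset (mp k) (t k))"
    by (intro sum.cong refl) (simp add: mp_def multiset_eq_iff count_sum)
  \<comment> \<open>Each cyclic module with exponent \<open>k\<close> supplies two factors of order
    \<open>p ^ k\<close>, whence the factor 2 in front of \<open>mp k\<close>.\<close>
  also have "\<dots> = (\<Sum>k\<in>?J. repeat_mset (2 * mp k) {#p ^ k#})"
    using I by (intro sum.mono_neutral_cong_right) (auto simp: t_def multiset_eq_iff count_sum)
  finally have "has_cyclic_type G (\<Sum>k\<in>?J. repeat_mset (2 * mp k) {#p ^ k#})"
    using G by simp
  moreover have "has_cyclic_type (sum_group {1..} ?C) (\<Sum>k\<in>?J. repeat_mset (2 * mp k) {#p ^ k#})"
  proof (rule has_cyclic_type_sum_group)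
    show "finite ?J" "?J \<subseteq> {1..}" using I by auto
    show "carrier (?C k) = {\<one>\<^bsub>?C k\<^esub>}" if "k \<in> {1..} - ?J" for k
      using that mp0[of k] by (auto simp: direct_power_def)
    show "has_cyclic_type (?C k) (repeat_mset (2 * mp k) {#p ^ k#})" for k
      by (intro has_cyclic_type_direct_power has_cyclic_type_integer_mod_group)
    then show "group (?C k)" for k by (rule has_cyclic_type_group)
  qed
  ultimately have "G \<cong> sum_group {1..} ?C" by (rule has_cyclic_type_unique)
  moreover have "finite {k. 1 \<le> k \<and> mp k \<noteq> 0}"
  proof (rule finite_subset[OF subsetI finite_imageI[OF I, of n]])
    fix k assume "k \<in> {k. 1 \<le> k \<and> mp k \<noteq> 0}"
    then have "mp k \<noteq> 0" by simp
    then show "k \<in> n ` I" using mp0[of k] by metis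
  qed
  ultimately show ?thesis by (intro exI[of _ mp] conjI)
qed

lemma primary_type_two:
  fixes G :: "('a, 'b) monoid_scheme"
  assumes cs: "complex_structure G f" and fin: "finite (carrier G)"
    and tors: "\<And>x. x \<in> carrier G \<Longrightarrow> \<exists>k::nat. x [^]\<^bsub>G\<^esub> (2 ^ k :: nat) = \<one>\<^bsub>G\<^esub>"
  shows "\<exists>(s::nat) (E::nat monoid) (a :: nat \<Rightarrow> nat) (b :: nat \<Rightarrow> nat).
    elementary_abelian_2_group E \<and>
    (\<forall>j\<in>{1..s}. 0 < a j \<and> 0 < b j \<and> \<bar>int (a j) - int (b j)\<bar> \<le> 1) \<and>
    G \<cong> E \<times>\<times> sum_group {1..s} (\<lambda>j. integer_mod_group (2 ^ a j) \<times>\<times> integer_mod_group (2 ^ b j))"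
proof -
  interpret euclidean_action G "gact G f" "\<lambda>z. nat (gnorm z)"
    using cs by (rule euclidean_action_gact)
  \<comment> \<open>Filtering leaves nothing for \<open>n = 0\<close>, a single factor of order 2
    for \<open>n = 1\<close>, and both factors from \<open>n = 2\<close> on.\<close>
  define t where "t = (\<lambda>n. filter_mset (\<lambda>k. k \<noteq> 1) {#2 ^ (Suc n div 2), 2 ^ (n div 2) :: nat#})"
  have "\<exists>(I :: 'a set) n. finite I \<and> has_cyclic_type G (\<Sum>i\<in>I. t (n i))"
  proof (rule primary_type[OF cs fin prime_elem_one_plus_i])
    fix x assume x: "x \<in> carrier G"
    then obtain k where k: "x [^]\<^bsub>G\<^esub> (2 ^ k :: nat) = \<one>\<^bsub>G\<^esub>" using tors by blast
    \<comment> \<open>The square of 1 + i is 2i, so being killed by \<open>2 ^ k\<close> implies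
      being killed by the power \<open>2 * k\<close> of 1 + i.\<close>
    have "Gauss 1 1 ^ (2 * k) = (Gauss 0 1 * Gauss 2 0) ^ k"
      by (simp add: power_mult gauss_int_defs power2_eq_square)
    also have "\<dots> = Gauss 0 1 ^ k * Gauss (int (2 ^ k)) 0"
      by (simp add: power_mult_distrib Gauss_power)
    finally have "gact G f (Gauss 1 1 ^ (2 * k)) x = \<one>\<^bsub>G\<^esub>"
      using k x by (simp only: smult_mult gact_int[OF cs x] int_pow_int smult_id)
    then show "\<exists>k. gact G f (Gauss 1 1 ^ k) x = \<one>\<^bsub>G\<^esub>" ..
  next
    fix C :: "('a, 'b) monoid_scheme" and y n
    assume "gauss_cyclic C f y (Gauss 1 1 ^ n)"
    then show "has_cyclic_type C (t n)"
      unfolding t_def by (intro has_cyclic_type_filter has_cyclic_type_gauss_cyclic_one_plus_i)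
  qed
  then obtain I :: "'a set" and n where I: "finite I" and G: "has_cyclic_type G (\<Sum>i\<in>I. t (n i))" by blast
  define I1 where "I1 = {i \<in> I. n i = 1}"
  define I2 where "I2 = {i \<in> I. n i \<ge> 2}"
  have fin12: "finite I1" "finite I2" using I by (auto simp: I1_def I2_def)
  obtain h where h: "bij_betw h {1..card I2} I2"
    using ex_bij_betw_nat_finite_1[OF fin12(2)] by blast
  define a where "a = (\<lambda>j. Suc (n (h j)) div 2)"
  define b where "b = (\<lambda>j. n (h j) div 2)"
  let ?C = "\<lambda>j. integer_mod_group (2 ^ a j) \<times>\<times> integer_mod_group (2 ^ b j)"
  have ab: "0 < a j \<and> 0 < b j \<and> \<bar>int (a j) - int (b j)\<bar> \<le> 1" if "j \<in> {1..card I2}" for j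
  proof -
    have "n (h j) \<ge> 2" using bij_betwE[OF h] that by (auto simp: I2_def)
    then show ?thesis unfolding a_def b_def by linarith
  qed
  have "(\<Sum>i\<in>I. t (n i)) = (\<Sum>i\<in>I1 \<union> I2. t (n i))"
    using I by (intro sum.mono_neutral_right) (auto simp: I1_def I2_def t_def not_le less_2_cases_iff)
  also have "\<dots> = (\<Sum>i\<in>I1. t (n i)) + (\<Sum>i\<in>I2. t (n i))"
    using fin12 by (intro sum.union_disjoint) (auto simp: I1_def I2_def)
  also have "(\<Sum>i\<in>I1. t (n i)) = repeat_mset (card I1) {#2#}"
    by (simp add: I1_def t_def multiset_eq_iff count_sum)
  also have "(\<Sum>i\<in>I2. t (n i)) = (\<Sum>j\<in>{1..card I2}. t (n (h j)))"
    using sum.reindex_bij_betw[OF h, of "\<lambda>i. t (n i)"] by simp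
  also have "\<dots> = (\<Sum>j\<in>{1..card I2}. {#2 ^ a j, 2 ^ b j#})"
    by (intro sum.cong refl) (use ab in \<open>auto simp: t_def a_def b_def\<close>)
  finally have G: "has_cyclic_type G (repeat_mset (card I1) {#2#} + (\<Sum>j\<in>{1..card I2}. {#2 ^ a j, 2 ^ b j#}))"
    using G by simp
  let ?E = "direct_power (integer_mod_group 2) (card I1)"
  have "group ?E" unfolding direct_power_def by (rule product_group) simp
  moreover have "finite (carrier ?E)"
    unfolding direct_power_def by (rule finite_product_group_carrier) (auto simp: carrier_integer_mod_group)
  ultimately obtain E :: "nat monoid" where E: "group E" "?E \<cong> E"
    using finite_group_iso_nat by blast
  have "comm_group ?E"
    unfolding direct_power_def by (rule comm_group_product_group) simp
  then have "comm_group E"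
    using comm_group.iso_imp_comm_group E group.is_monoid by blast
  moreover have "x \<otimes>\<^bsub>E\<^esub> x = \<one>\<^bsub>E\<^esub>" if "x \<in> carrier E" for x
  proof -
    obtain e where e: "e \<in> iso ?E E" using E(2) by (auto simp: is_iso_def)
    then obtain z where z: "z \<in> carrier ?E" "x = e z"
      using \<open>x \<in> carrier E\<close> by (auto simp: iso_def bij_betw_def)
    have hom: "e \<in> hom ?E E" using e by (simp add: iso_def)
    have "z \<otimes>\<^bsub>?E\<^esub> z = \<one>\<^bsub>?E\<^esub>"
      by (simp add: direct_power_def fun_eq_iff)
    then have "x \<otimes>\<^bsub>E\<^esub> x = e \<one>\<^bsub>?E\<^esub>"
      using hom_mult[OF hom z(1) z(1)] z(2) by simp
    also have "\<dots> = \<one>\<^bsub>E\<^esub>"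
      using hom \<open>group ?E\<close> E(1) by (rule hom_one)
    finally show ?thesis .
  qed
  ultimately have "elementary_abelian_2_group E"
    by (simp add: elementary_abelian_2_group_def)
  moreover have "has_cyclic_type E (repeat_mset (card I1) {#2#})"
    using has_cyclic_type_direct_power[OF has_cyclic_type_integer_mod_group] E(2,1) by (rule has_cyclic_type_iso)
  moreover have "has_cyclic_type (sum_group {1..card I2} ?C) (\<Sum>j\<in>{1..card I2}. {#2 ^ a j#} + {#2 ^ b j#})"
  proof (rule has_cyclic_type_sum_group)
    show "has_cyclic_type (?C j) ({#2 ^ a j#} + {#2 ^ b j#})" for j
      by (intro has_cyclic_type_DirProd has_cyclic_type_integer_mod_group)
    then show "group (?C j)" for j by (rule has_cyclic_type_group)
  qed auto
  ultimately have "has_cyclic_type (E \<times>\<times> sum_group {1..card I2} ?C)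
      (repeat_mset (card I1) {#2#} + (\<Sum>j\<in>{1..card I2}. {#2 ^ a j#} + {#2 ^ b j#}))"
    by (intro has_cyclic_type_DirProd)
  then have "G \<cong> E \<times>\<times> sum_group {1..card I2} ?C"
    using G by (intro has_cyclic_type_unique) (simp_all add: add_mset_commute)
  then show ?thesis
    using \<open>elementary_abelian_2_group E\<close> ab
    by (intro exI[of _ "card I2"] exI[of _ E] exI[of _ a] exI[of _ b]) simp
qed

subsection \<open>Inverse ambiguous automorphisms\<close>

text \<open>Applying \<open>f\<close> to the inverse ambiguity equation turns it into
  \<open>x = f (inv (f x))\<close>, hence into \<open>f (f x) = inv x\<close>. Conversely,
  \<open>inv (f x)\<close> then provides a two-sided inverse map of \<open>f\<close>.\<close>

lemma complex_structure_iff_inverse_ambiguous: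
  fixes G (structure)
  assumes "comm_group G"
  shows "complex_structure G f \<longleftrightarrow> inverse_ambiguous_automorphism G f"
proof -
  interpret comm_group G by fact
  show ?thesis
  proof
    assume cs: "complex_structure G f"
    note [simp] = complex_structureD(4,5)[OF cs]
    interpret f: group_hom G G f
      using complex_structureD(3)[OF cs] by unfold_locales
    have bij: "bij_betw f (carrier G) (carrier G)"
      by (rule bij_betw_byWitness[where f' = "\<lambda>x. inv (f x)"]) auto
    moreover have "inv_into (carrier G) f x = inv (f x)" if "x \<in> carrier G" for x
      using that bij by (intro inv_into_f_eq) (auto simp: bij_betw_def)
    ultimately show "inverse_ambiguous_automorphism G f"
      using complex_structureD(3)[OF cs]
      by (simp add: inverse_ambiguous_automorphism_def inverse_ambiguous_def iso_def)
  next
    assume "inverse_ambiguous_automorphism G f"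
    then have f: "f \<in> hom G G" and bij: "bij_betw f (carrier G) (carrier G)"
      and amb: "\<And>x. x \<in> carrier G \<Longrightarrow> inv_into (carrier G) f x = inv (f x)"
      by (auto simp: inverse_ambiguous_automorphism_def inverse_ambiguous_def iso_def)
    interpret f: group_hom G G f
      using f by unfold_locales
    have "f (f x) = inv x" if "x \<in> carrier G" for x
    proof -
      have "f (inv (f x)) = x"
        using that bij by (metis amb bij_betw_imp_surj_on f_inv_into_f)
      then have "inv (f (f x)) = x" using that by simp
      then show ?thesis using that by (metis f.hom_closed inv_inv)
    qed
    then show "complex_structure G f"
      using f by (simp add: complex_structure_def comm_group_axioms)
  qed
qed

subsection \<open>Constructing complex structures\<close>

lemma complex_structure_DirProd:
  assumes "complex_structure G f" "complex_structure H g"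
  shows "complex_structure (G \<times>\<times> H) (\<lambda>(x, y). (f x, g y))"
proof -
  note D = complex_structureD[OF assms(1)] complex_structureD[OF assms(2)]
  have "comm_group (G \<times>\<times> H)"
    by (rule group.group_comm_groupI[OF DirProd_group]) (use D in \<open>auto simp: comm_groupE(4)\<close>)
  then show ?thesis
    using D by (auto simp: complex_structure_def hom_def)
qed

lemma complex_structure_finite_sum_group:
  assumes "finite J" "J \<subseteq> I" "\<And>i. i \<in> J \<Longrightarrow> \<exists>f. complex_structure (G i) f"
    "\<And>i. i \<in> I \<Longrightarrow> group (G i)" "\<And>i. i \<in> I - J \<Longrightarrow> carrier (G i) = {\<one>\<^bsub>G i\<^esub>}"
  shows "\<exists>f. complex_structure (sum_group I G) f"
proof -
  obtain f where f: "complex_structure (product_group J G) f"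
    using complex_structure_product_group[of J G] assms(3) by blast
  have "sum_group I G \<cong> product_group J G"
    by (rule product_group_subset_iso_sum_group[OF assms(1,2,4,5)])
  then have "product_group J G \<cong> sum_group I G"
    by (rule group.iso_sym[OF sum_group[OF assms(4)], rotated])
  then show ?thesis
    by (rule complex_structure_iso[OF f _ sum_group[OF assms(4)]])
qed

text \<open>A pair stands for x + iy in additive notation, and i times it is -y + ix.\<close>

lemma complex_structure_square:
  assumes "comm_group G"
  shows "complex_structure (G \<times>\<times> G) (\<lambda>(x, y). (inv\<^bsub>G\<^esub> y, x))"
proof -
  interpret comm_group G by fact
  have "comm_group (G \<times>\<times> G)"
    by (rule group.group_comm_groupI[OF DirProd_group]) (auto simp: m_comm)
  then show ?thesis
    by (auto simp: complex_structure_def hom_def inv_mult)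
qed

text \<open>Coordinates \<open>2 * k\<close> and \<open>Suc (2 * k)\<close> serve as real and
  imaginary part; evenness of the number of coordinates gives each one a partner.\<close>

lemma complex_structure_even_direct_power:
  fixes G (structure)
  assumes "comm_group G"
  shows "\<exists>f. complex_structure (direct_power G (2 * n)) f"
proof -
  interpret comm_group G by fact
  let ?P = "product_group {..<2 * n} (\<lambda>_. G)"
  define f where "f = (\<lambda>x. \<lambda>i\<in>{..<2 * n}. if even i then inv (x (Suc i)) else x (i - 1))"
  have lt: "Suc i < 2 * n" if "i < 2 * n" "even i" for i
    using that by (auto elim!: evenE)
  have "comm_group ?P" using assms by (rule comm_group_product_group)
  moreover have "f \<in> hom ?P ?P"
    using lt by (intro homI) (auto simp: f_def PiE_iff fun_eq_iff inv_mult)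
  moreover have "f (f x) = inv\<^bsub>?P\<^esub> x" if "x \<in> carrier ?P" for x
    using that lt by (subst inv_product_group) (auto simp: f_def PiE_iff fun_eq_iff elim!: oddE)
  ultimately show ?thesis
    unfolding complex_structure_def direct_power_def by blast
qed

text \<open>Inversion is the identity here, so the identity is a square root of it.\<close>

lemma complex_structure_elementary:
  assumes "comm_group G" "\<And>x. x \<in> carrier G \<Longrightarrow> x \<otimes>\<^bsub>G\<^esub> x = \<one>\<^bsub>G\<^esub>"
  shows "complex_structure G id"
proof -
  interpret comm_group G by fact
  show ?thesis
    using assms(2)
    by (auto simp: complex_structure_def hom_def comm_group_axioms intro!: inv_equality[symmetric])
qed

text \<open>The group \<open>\<int>[i]/(1 + i)\<^bsup>2b+1\<^esup>\<close> in the basis \<open>1\<close>, \<open>1 + i\<close>, whose elements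
  have additive orders \<open>2\<^bsup>b+1\<^esup>\<close> and \<open>2\<^sup>b\<close>: multiplication by \<open>i\<close> sends \<open>1\<close> to \<open>-1 + (1 + i)\<close> and
  \<open>1 + i\<close> to \<open>-2 + (1 + i)\<close>.\<close>

lemma complex_structure_two_consecutive:
  "complex_structure (integer_mod_group (2 ^ Suc b) \<times>\<times> integer_mod_group (2 ^ b))
     (\<lambda>(x, y). ((- x - 2 * y) mod 2 ^ Suc b, (x + y) mod 2 ^ b))"
proof -
  define M N :: int where "M = 2 ^ Suc b" and "N = 2 ^ b"
  define G where "G = integer_mod_group (2 ^ Suc b) \<times>\<times> integer_mod_group (2 ^ b)"
  let ?f = "\<lambda>(x::int, y::int). ((- x - 2 * y) mod M, (x + y) mod N)"
  have carrier: "carrier G = {0..<M} \<times> {0..<N}"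
    by (simp add: G_def carrier_integer_mod_group M_def N_def)
  have mult: "(x, y) \<otimes>\<^bsub>G\<^esub> (x', y') = ((x + x') mod M, (y + y') mod N)" for x y x' y'
    by (simp add: G_def M_def N_def)
  have inv: "inv\<^bsub>G\<^esub> (x, y) = (- x mod M, - y mod N)" if "(x, y) \<in> carrier G" for x y
    using that by (simp add: G_def M_def N_def)
  \<comment> \<open>As \<open>M = 2 * N\<close>, the coefficient 2 of \<open>y\<close> makes the
    first coordinate well defined although \<open>y\<close> is known modulo \<open>N\<close>
    only.\<close>
  have "[2 * (v mod N) = 2 * v] (mod M)" for v
    by (simp add: cong_def M_def N_def flip: mult_mod_right)
  then have first: "(- (u mod M) - 2 * (v mod N)) mod M = (- u - 2 * v) mod M" for u v
    unfolding cong_def by (metis mod_diff_eq mod_minus_eq)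
  \<comment> \<open>The second coordinate is well defined because \<open>N\<close> divides
    \<open>M\<close>.\<close>
  have "[u mod M = u] (mod N)" for u
    by (simp add: cong_def M_def N_def mod_mod_cancel)
  then have second: "(u mod M + v mod N) mod N = (u + v) mod N" for u v
    unfolding cong_def by (metis mod_add_eq mod_mod_trivial)
  have "comm_group G"
    unfolding G_def by (rule group.group_comm_groupI[OF DirProd_group]) (auto simp: add.commute)
  moreover have "?f \<in> hom G G"
  proof (rule homI)
    fix u v :: "int \<times> int"
    obtain x y x' y' where uv: "u = (x, y)" "v = (x', y')" by (cases u, cases v)
    have "- (x + x') - 2 * (y + y') = (- x - 2 * y) + (- x' - 2 * y')" "(x + x') + (y + y') = (x + y) + (x' + y')"
      by simp_all
    then show "?f (u \<otimes>\<^bsub>G\<^esub> v) = ?f u \<otimes>\<^bsub>G\<^esub> ?f v"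
      by (simp only: uv mult prod.case first second mod_add_eq)
  qed (auto simp: carrier M_def N_def)
  \<comment> \<open>The integer matrix with rows (-1, -2) and (1, 1) has trace 0 and determinant 1,
    so its square is -1.\<close>
  moreover have "?f (?f u) = inv\<^bsub>G\<^esub> u" if "u \<in> carrier G" for u
    using that by (cases u) (simp add: inv first second)
  ultimately show ?thesis
    by (simp add: complex_structure_def G_def M_def N_def)
qed

lemma complex_structure_two_pair:
  assumes "\<bar>int a - int b\<bar> \<le> 1"
  shows "\<exists>f. complex_structure (integer_mod_group (2 ^ a) \<times>\<times> integer_mod_group (2 ^ b)) f"
proof -
  consider "a = b" | "a = Suc b" | "b = Suc a" using assms by linarith
  then show ?thesis
  proof cases
    case 1
    then show ?thesis using complex_structure_square[OF abelian_integer_mod_group] by blast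
  next
    case 2
    then show ?thesis using complex_structure_two_consecutive by blast
  next
    case 3
    then show ?thesis
      by (intro complex_structure_iso[OF complex_structure_two_consecutive[of a]])
        (simp_all only: DirProd_commute_iso DirProd_group group_integer_mod_group)
  qed
qed

text \<open>Multiplication by an integer root of -1 modulo an exponent of the group refers to no
  decomposition of it, so it works on groups of arbitrary shape with that exponent.\<close>

lemma complex_structure_pow:
  fixes G (structure)
  assumes "comm_group G" "\<And>x. x \<in> carrier G \<Longrightarrow> x [^]\<^bsub>G\<^esub> (n::nat) = \<one>\<^bsub>G\<^esub>" "[i\<^sup>2 = -1] (mod int n)"
  shows "complex_structure G (\<lambda>x. x [^]\<^bsub>G\<^esub> i)"
proof -
  interpret comm_group G by fact
  have "(x [^] i) [^] i = inv x" if x: "x \<in> carrier G" for x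
  proof -
    obtain k where "i\<^sup>2 + 1 = int n * k" using assms(3) by (auto simp: cong_iff_dvd_diff)
    then have "i * i = int n * k + (- 1)" by (simp add: power2_eq_square)
    then have "(x [^] i) [^] i = x [^] (int n * k) \<otimes> x [^] (- 1 :: int)"
      using x by (simp only: int_pow_pow int_pow_mult)
    also have "x [^] (int n * k) = (x [^] n) [^] k"
      using x by (simp flip: int_pow_pow int_pow_int)
    finally show ?thesis using x assms(2) by (simp add: int_pow_neg)
  qed
  then show ?thesis
    by (simp add: complex_structure_def comm_group_axioms hom_def int_pow_distrib)
qed

subsection \<open>Gluing over the primary components\<close>

text \<open>Torsion for a fixed \<open>n\<close>, unlike \<open>primary_component\<close>, also
  covers several primes at once, which allows an induction over the primes dividing the group
  order.\<close>

definition pow_kernel :: "('a, 'b) monoid_scheme \<Rightarrow> nat \<Rightarrow> ('a, 'b) monoid_scheme"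
  where "pow_kernel G n = G\<lparr>carrier := {x \<in> carrier G. x [^]\<^bsub>G\<^esub> n = \<one>\<^bsub>G\<^esub>}\<rparr>"

lemma (in comm_group) subgroup_pow_kernel: "subgroup {x \<in> carrier G. x [^] (n::nat) = \<one>} G"
  by (rule subgroupI) (auto simp: nat_pow_inv nat_pow_distrib intro: exI[of _ "\<one>"])

lemma (in comm_group) comm_group_pow_kernel: "comm_group (pow_kernel G n)"
  unfolding pow_kernel_def
  by (rule group.group_comm_groupI[OF subgroup.subgroup_is_group[OF subgroup_pow_kernel is_group]])
    (auto simp: m_comm)

text \<open>With \<open>u * a + v * b = 1\<close>, every \<open>x\<close> is the product of its
  powers to \<open>b * v\<close> and \<open>a * u\<close>, which \<open>a\<close> and
  \<open>b\<close> kill respectively. The same identity shows that an element killed by both numbers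
  is trivial.\<close>

lemma (in comm_group) pow_kernel_coprime_iso:
  assumes "coprime a b" "\<And>x. x \<in> carrier G \<Longrightarrow> x [^] (a * b) = \<one>"
  shows "pow_kernel G a \<times>\<times> pow_kernel G b \<cong> G"
proof -
  obtain u v where uv: "u * int a + v * int b = 1"
    using assms(1) bezout_int[of "int a" "int b"] by auto
  have split: "x = (x [^] b) [^] v \<otimes> (x [^] a) [^] u" if "x \<in> carrier G" for x
  proof -
    have "(x [^] b) [^] v \<otimes> (x [^] a) [^] u = x [^] (int b * v + int a * u)"
      using that by (simp add: int_pow_mult flip: int_pow_int int_pow_pow)
    also have "int b * v + int a * u = 1" using uv by (simp add: mult.commute)
    finally show ?thesis using that by simp
  qed
  let ?h = "\<lambda>(x, y). x \<otimes> y"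
  interpret KK: group "pow_kernel G a \<times>\<times> pow_kernel G b"
    using comm_group_pow_kernel by (intro DirProd_group) (simp_all add: comm_group_def)
  have hom: "?h \<in> hom (pow_kernel G a \<times>\<times> pow_kernel G b) G"
    by (rule homI) (auto simp: pow_kernel_def m_ac)
  interpret h: group_hom "pow_kernel G a \<times>\<times> pow_kernel G b" G ?h
    using hom by unfold_locales
  have "?h \<in> iso (pow_kernel G a \<times>\<times> pow_kernel G b) G"
  proof (rule isoI[OF hom])
    have "inj_on ?h (carrier (pow_kernel G a \<times>\<times> pow_kernel G b))"
      unfolding h.inj_on_one_iff
    proof (intro allI impI)
      fix z assume z: "z \<in> carrier (pow_kernel G a \<times>\<times> pow_kernel G b)" "?h z = \<one>"
      obtain x y where xy: "z = (x, y)" by (cases z)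
      then have x: "x \<in> carrier G" "x [^] a = \<one>" and y: "y \<in> carrier G" "y [^] b = \<one>" and "x \<otimes> y = \<one>"
        using z by (auto simp: pow_kernel_def)
      then have "x = inv y" by (simp add: inv_equality)
      then have "x [^] b = \<one>" using y by (simp add: nat_pow_inv)
      then have "x = \<one>" using split[OF x(1)] x(2) by simp
      then show "z = \<one>\<^bsub>pow_kernel G a \<times>\<times> pow_kernel G b\<^esub>"
        using xy \<open>x \<otimes> y = \<one>\<close> y by (simp add: pow_kernel_def)
    qed
    moreover have "x \<in> ?h ` carrier (pow_kernel G a \<times>\<times> pow_kernel G b)" if x: "x \<in> carrier G" for x
    proof (rule image_eqI[of _ _ "((x [^] b) [^] v, (x [^] a) [^] u)"])
      have "((x [^] b) [^] v) [^] a = \<one>"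
      proof -
        have "((x [^] b) [^] v) [^] a = (x [^] (a * b)) [^] v"
          using x by (simp add: int_pow_pow mult_ac flip: int_pow_int)
        then show ?thesis using assms(2)[OF x] by simp
      qed
      moreover have "((x [^] a) [^] u) [^] b = \<one>"
      proof -
        have "((x [^] a) [^] u) [^] b = (x [^] (a * b)) [^] u"
          using x by (simp add: int_pow_pow mult_ac flip: int_pow_int)
        then show ?thesis using assms(2)[OF x] by simp
      qed
      ultimately show "((x [^] b) [^] v, (x [^] a) [^] u) \<in> carrier (pow_kernel G a \<times>\<times> pow_kernel G b)"
        using x by (simp add: pow_kernel_def)
    qed (use split[OF x] in simp)
    ultimately show "bij_betw ?h (carrier (pow_kernel G a \<times>\<times> pow_kernel G b)) (carrier G)"
      by (auto simp: bij_betw_def pow_kernel_def)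
  qed
  then show ?thesis by (rule is_isoI)
qed

lemma (in comm_group) pow_kernel_pow_kernel:
  assumes "a dvd n"
  shows "pow_kernel (pow_kernel G n) a = pow_kernel G a"
proof -
  obtain b where n: "n = a * b" using assms by (elim dvdE)
  have "x [^] n = \<one>" if "x \<in> carrier G" "x [^] a = \<one>" for x
    unfolding n using that by (simp flip: nat_pow_pow)
  then show ?thesis
    by (auto simp: pow_kernel_def nat_pow_def intro!: arg_cong[where f = "\<lambda>X. G\<lparr>carrier := X\<rparr>"])
qed

text \<open>Each new prime is split off inside the torsion subgroup for the enlarged product, whose
  own torsion for either factor agrees with that of \<open>G\<close>.\<close>

lemma (in comm_group) complex_structure_pow_kernel_prod:
  assumes "finite S" "\<And>p. p \<in> S \<Longrightarrow> Factorial_Ring.prime p"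
    "\<And>p. p \<in> S \<Longrightarrow> \<exists>f. complex_structure (pow_kernel G (p ^ e p)) f"
  shows "\<exists>f. complex_structure (pow_kernel G (\<Prod>p\<in>S. p ^ e p)) f"
  using assms
proof (induction S)
  case empty
  have "complex_structure (pow_kernel G 1) id"
    by (rule complex_structure_elementary[OF comm_group_pow_kernel]) (auto simp: pow_kernel_def)
  then show ?case by auto
next
  case (insert p S)
  let ?a = "p ^ e p" and ?b = "\<Prod>p\<in>S. p ^ e p"
  have "coprime ?a ?b"
    using insert.prems(1) insert.hyps(2)
    by (intro prod_coprime_right) (metis coprime_power_left_iff coprime_power_right_iff insertCI primes_coprime)
  interpret K: comm_group "pow_kernel G (?a * ?b)" by (rule comm_group_pow_kernel)
  have "pow_kernel (pow_kernel G (?a * ?b)) ?a \<times>\<times> pow_kernel (pow_kernel G (?a * ?b)) ?b \<cong> pow_kernel G (?a * ?b)"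
    using \<open>coprime ?a ?b\<close> by (rule K.pow_kernel_coprime_iso) (auto simp: pow_kernel_def nat_pow_def)
  then have "pow_kernel G ?a \<times>\<times> pow_kernel G ?b \<cong> pow_kernel G (?a * ?b)"
    by (simp add: pow_kernel_pow_kernel)
  moreover have "\<exists>f. complex_structure (pow_kernel G ?a \<times>\<times> pow_kernel G ?b) f"
    using insert.IH insert.prems complex_structure_DirProd by (metis insertCI)
  ultimately have "\<exists>f. complex_structure (pow_kernel G (?a * ?b)) f"
    using complex_structure_iso K.is_group by blast
  then show ?case using insert.hyps by simp
qed

text \<open>An element of the component has \<open>p\<close>-power order dividing the group order,
  by Lagrange. This yields one exponent for the whole component, needed both for gluing and for the
  choice of a root of -1.\<close>

lemma (in comm_group) primary_component_eq_pow_kernel: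
  assumes "finite (carrier G)" "Factorial_Ring.prime p"
  shows "primary_component p G = pow_kernel G (p ^ multiplicity p (order G))"
proof -
  have "x [^] (p ^ multiplicity p (order G)) = \<one>" if x: "x \<in> carrier G" "x [^] (p ^ k) = \<one>" for x and k :: nat
  proof -
    have "ord x dvd p ^ k" using x by (simp add: pow_eq_id)
    then obtain j where j: "ord x = p ^ j" using assms(2) by (auto simp: divides_primepow_nat)
    have "ord x dvd order G"
      using x(1) pow_order_eq_1 by (simp flip: pow_eq_id)
    moreover have "order G \<noteq> 0" using assms(1) by (simp add: order_gt_0_iff_finite[symmetric])
    ultimately have "j \<le> multiplicity p (order G)"
      unfolding j using assms(2) by (intro multiplicity_geI) auto
    then have "ord x dvd p ^ multiplicity p (order G)" unfolding j by (rule le_imp_power_dvd)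
    then show ?thesis using x by (simp add: pow_eq_id)
  qed
  then show ?thesis
    unfolding primary_component_def pow_kernel_def
    by (intro arg_cong[where f = "\<lambda>X. G\<lparr>carrier := X\<rparr>"]) auto
qed

text \<open>The product of the maximal prime powers dividing the order is the order itself, which
  annihilates all of \<open>G\<close>.\<close>

lemma (in comm_group) complex_structure_from_primary_components:
  assumes "finite (carrier G)"
    "\<And>p. Factorial_Ring.prime p \<Longrightarrow> \<exists>f. complex_structure (primary_component p G) f"
  shows "\<exists>f. complex_structure G f"
proof -
  have n: "order G \<noteq> 0" using assms(1) by (simp add: order_gt_0_iff_finite[symmetric])
  have "\<exists>f. complex_structure (pow_kernel G (\<Prod>p\<in>prime_factors (order G). p ^ multiplicity p (order G))) f"
    using assms primary_component_eq_pow_kernel[OF assms(1)]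
    by (intro complex_structure_pow_kernel_prod) auto
  moreover have "(\<Prod>p\<in>prime_factors (order G). p ^ multiplicity p (order G)) = order G"
    using n by (simp add: prime_factorization_nat[symmetric])
  moreover have "pow_kernel G (order G) = G"
    using pow_order_eq_1 by (simp add: pow_kernel_def cong: conj_cong)
  ultimately show ?thesis by simp
qed

lemma (in comm_group) complex_structure_primary_component_iso:
  assumes "primary_component p G \<cong> H" "complex_structure H g"
  shows "\<exists>f. complex_structure (primary_component p G) f"
proof -
  have grp: "group (primary_component p G)"
    unfolding primary_component_def
    by (rule subgroup.subgroup_is_group[OF subgroup_primary_component is_group])
  show ?thesis
    using complex_structure_iso[OF assms(2) group.iso_sym[OF grp assms(1)] grp] .
qed

theorem corollary4p3:
  fixes A :: "('a, 'b) monoid_scheme"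
  assumes "comm_group A"
    and "infinite (carrier A)"
    and "finitely_generated_group A"
  shows "(\<exists>f. inverse_ambiguous_automorphism A f) \<longleftrightarrow>
    (\<exists>(m::nat) (T::nat monoid).
       m \<ge> 1 \<and> comm_group T \<and> finite (carrier T) \<and>
       A \<cong> direct_power integer_group (2 * m) \<times>\<times> T \<and>
       (\<forall>p::nat. Factorial_Ring.prime p \<longrightarrow> [p = 3] (mod 4) \<longrightarrow>
          (\<exists>mp :: nat \<Rightarrow> nat. finite {k. 1 \<le> k \<and> mp k \<noteq> 0} \<and>
             primary_component p T \<cong>
               sum_group {1..} (\<lambda>k. direct_power (integer_mod_group (p ^ k)) (2 * mp k)))) \<and>
       (\<exists>(s::nat) (E::nat monoid) (a :: nat \<Rightarrow> nat) (b :: nat \<Rightarrow> nat).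
          elementary_abelian_2_group E \<and>
          (\<forall>j\<in>{1..s}. 0 < a j \<and> 0 < b j \<and> \<bar>int (a j) - int (b j)\<bar> \<le> 1) \<and>
          primary_component 2 T \<cong>
            E \<times>\<times> sum_group {1..s}
              (\<lambda>j. integer_mod_group (2 ^ a j) \<times>\<times> integer_mod_group (2 ^ b j))))"
  (is "?L \<longleftrightarrow> (\<exists>m T. ?R m T)")
proof
  assume ?L
  then obtain f where f: "complex_structure A f"
    using complex_structure_iff_inverse_ambiguous[OF assms(1)] by blast
  obtain m and T :: "nat monoid" and g where iso: "A \<cong> direct_power integer_group (2 * m) \<times>\<times> T"
    and T: "finite (carrier T)" "complex_structure T g"
    using complex_structure_free_finite_decomposition[OF f assms(3)] by blast
  have "m \<noteq> 0"
  proof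
    assume "m = 0"
    then have "finite (carrier (direct_power integer_group (2 * m) \<times>\<times> T))"
      using T(1) by (simp add: direct_power_def)
    then show False using iso_finite[OF iso] assms(2) by blast
  qed
  have fin: "finite (carrier (primary_component p T))" for p
    using T(1) by (simp add: primary_component_def)
  have "?R m T"
  proof (intro conjI allI impI)
    show "\<exists>mp :: nat \<Rightarrow> nat. finite {k. 1 \<le> k \<and> mp k \<noteq> 0} \<and>
        primary_component p T \<cong> sum_group {1..} (\<lambda>k. direct_power (integer_mod_group (p ^ k)) (2 * mp k))"
      if "Factorial_Ring.prime p" "[p = 3] (mod 4)" for p
      using complex_structure_primary_component[OF T(2)] fin that primary_component_pow
      by (rule primary_type_inert)
    show "\<exists>(s::nat) (E::nat monoid) (a :: nat \<Rightarrow> nat) (b :: nat \<Rightarrow> nat).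
        elementary_abelian_2_group E \<and>
        (\<forall>j\<in>{1..s}. 0 < a j \<and> 0 < b j \<and> \<bar>int (a j) - int (b j)\<bar> \<le> 1) \<and>
        primary_component 2 T \<cong>
          E \<times>\<times> sum_group {1..s} (\<lambda>j. integer_mod_group (2 ^ a j) \<times>\<times> integer_mod_group (2 ^ b j))"
      using complex_structure_primary_component[OF T(2)] fin primary_component_pow
      by (rule primary_type_two)
  qed (use \<open>m \<noteq> 0\<close> T iso complex_structureD(1)[OF T(2)] in auto)
  then show "\<exists>m T. ?R m T" by (intro exI)
next
  assume "\<exists>m T. ?R m T"
  then obtain m T where "?R m T" by (elim exE)
  then have T: "comm_group T" "finite (carrier T)"
    and iso: "A \<cong> direct_power integer_group (2 * m) \<times>\<times> T"
    and inert: "\<forall>p::nat. Factorial_Ring.prime p \<longrightarrow> [p = 3] (mod 4) \<longrightarrow>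
      (\<exists>mp :: nat \<Rightarrow> nat. finite {k. 1 \<le> k \<and> mp k \<noteq> 0} \<and>
        primary_component p T \<cong> sum_group {1..} (\<lambda>k. direct_power (integer_mod_group (p ^ k)) (2 * mp k)))"
    and two: "\<exists>(s::nat) (E::nat monoid) (a :: nat \<Rightarrow> nat) (b :: nat \<Rightarrow> nat).
      elementary_abelian_2_group E \<and>
      (\<forall>j\<in>{1..s}. 0 < a j \<and> 0 < b j \<and> \<bar>int (a j) - int (b j)\<bar> \<le> 1) \<and>
      primary_component 2 T \<cong>
        E \<times>\<times> sum_group {1..s} (\<lambda>j. integer_mod_group (2 ^ a j) \<times>\<times> integer_mod_group (2 ^ b j))"
    by - (elim conjE, assumption)+
  interpret T: comm_group T by fact
  note transfer = T.complex_structure_primary_component_iso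
  have "\<exists>f. complex_structure T f"
  proof (rule T.complex_structure_from_primary_components[OF T(2)])
    fix p :: nat assume p: "Factorial_Ring.prime p"
    have "p = 2 \<or> [p = 1] (mod 4) \<or> [p = 3] (mod 4)"
    proof (cases "p = 2")
      case False
      then have "odd p" using p primes_dvd_imp_eq two_is_prime_nat by blast
      then have "p mod 4 = 1 \<or> p mod 4 = 3" by presburger
      then show ?thesis by (auto simp: cong_def)
    qed simp
    then consider "p = 2" | "[p = 1] (mod 4)" | "[p = 3] (mod 4)" by blast
    then show "\<exists>f. complex_structure (primary_component p T) f"
    proof cases
      case 1
      obtain s and E :: "nat monoid" and a b :: "nat \<Rightarrow> nat" where E: "elementary_abelian_2_group E"
        and ab: "\<And>j. j \<in> {1..s} \<Longrightarrow> \<bar>int (a j) - int (b j)\<bar> \<le> 1"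
        and iso2: "primary_component 2 T \<cong>
          E \<times>\<times> sum_group {1..s} (\<lambda>j. integer_mod_group (2 ^ a j) \<times>\<times> integer_mod_group (2 ^ b j))"
        using two by blast
      have "\<exists>f. complex_structure (sum_group {1..s} (\<lambda>j. integer_mod_group (2 ^ a j) \<times>\<times> integer_mod_group (2 ^ b j))) f"
        by (rule complex_structure_finite_sum_group[where J = "{1..s}"])
          (use ab complex_structure_two_pair in \<open>auto intro!: DirProd_group\<close>)
      then obtain g where g: "complex_structure
          (sum_group {1..s} (\<lambda>j. integer_mod_group (2 ^ a j) \<times>\<times> integer_mod_group (2 ^ b j))) g" ..
      have "complex_structure E id"
        using E by (intro complex_structure_elementary) (simp_all add: elementary_abelian_2_group_def)
      from transfer[OF iso2 complex_structure_DirProd[OF this g]] show ?thesis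
        using 1 by simp
    next
      case 2
      \<comment> \<open>This power of \<open>p\<close> kills the component, so a root of -1 modulo
        it acts as required. If \<open>p\<close> does not divide the order, the power is 1 and the
        component is trivial.\<close>
      let ?n = "p ^ multiplicity p (order T)"
      obtain i where "[i\<^sup>2 = -1] (mod int p ^ multiplicity p (order T))"
        using sqrt_minus_one_mod_prime_power[OF p 2] by blast
      then have "[i\<^sup>2 = -1] (mod int ?n)" by simp
      then have "complex_structure (pow_kernel T ?n) (\<lambda>x. x [^]\<^bsub>pow_kernel T ?n\<^esub> i)"
        by (intro complex_structure_pow[where n = ?n] T.comm_group_pow_kernel) (auto simp: pow_kernel_def nat_pow_def)
      then show ?thesis
        using T.primary_component_eq_pow_kernel[OF T(2) p] by auto
    next
      case 3
      obtain mp :: "nat \<Rightarrow> nat" where mp: "finite {k. 1 \<le> k \<and> mp k \<noteq> 0}"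
        and iso3: "primary_component p T \<cong> sum_group {1..} (\<lambda>k. direct_power (integer_mod_group (p ^ k)) (2 * mp k))"
        using inert p 3 by blast
      have "\<exists>f. complex_structure (sum_group {1..} (\<lambda>k. direct_power (integer_mod_group (p ^ k)) (2 * mp k))) f"
      \<comment> \<open>Outside the finite set in \<open>mp\<close> the summands are zeroth powers,
        hence trivial.\<close>
      proof (rule complex_structure_finite_sum_group[OF mp])
        show "\<exists>f. complex_structure (direct_power (integer_mod_group (p ^ k)) (2 * mp k)) f" for k
          by (rule complex_structure_even_direct_power) simp
      qed (auto simp: direct_power_def)
      then show ?thesis using transfer[OF iso3] by blast
    qed
  qed
  moreover have "\<exists>f. complex_structure (direct_power integer_group (2 * m)) f"
    by (rule complex_structure_even_direct_power[OF abelian_integer_group])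
  ultimately obtain h where h: "complex_structure (direct_power integer_group (2 * m) \<times>\<times> T) h"
    using complex_structure_DirProd by blast
  have A: "group A" using assms(1) by (simp add: comm_group_def)
  have "\<exists>f. complex_structure A f"
    using complex_structure_iso[OF h group.iso_sym[OF A iso] A] .
  then show ?L
    using complex_structure_iff_inverse_ambiguous[OF assms(1)] by blast
qed

end
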